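(* Let $X$ be a real hyperelliptic curve of genus $g\ge 1$ with $n(X)\ge 1$ real connected components, given by the affine equation $$y^2=f(x)=x\prod_{i=1}^{2n(X)-2}(x-p_i)\prod_{j=1}^{g+1-n(X)}(x-q_j)(x-\overline{q_j}),$$ where the $p_i\in\mathbb{R}^*$ and $q_j\in\mathbb{C}\setminus\mathbb{R}$ are such that all roots $0,p_i,q_j,\overline{q_j}$ of $f$ are distinct, and let $k>g$. Then the complete real linear series $|\mathcal{L}_{\mathbb{R}}(kD)|$ on $X$ has at least $g(g+1)\,n(X)$ real inflection points (counted with inflectionary weight).
   Context: $X$ denotes the smooth projective complex curve compactifying the affine curve $y^2=f(x)$ by one point $\infty$, with the antiholomorphic involution $\sigma_X$ extending $(x,y)\mapsto(\overline{x},\overline{y})$. $X(\mathbb{R})$ is the fixed locus of $\sigma_X$ and $n(X)$ is its number of connected components. The hyperelliptic structure map is $\pi:X\to\mathbb{P}^1$, $(x,y)\mapsto x$, and $D=2\cdot\infty=\pi^*(\infty)$. $\mathcal{L}_{\mathbb{R}}(kD)$ is the real line bundle defined by $kD$ and $|\mathcal{L}_{\mathbb{R}}(kD)|$ is the complete real linear series given by the space of all real sections $H^0(X_{\mathbb{R}},\mathcal{L}_{\mathbb{R}}(kD))$. For a linear series with section space $V$ of dimension $r+1$ and a point $p\in X$, let $o_0<\dots<o_r$ be the vanishing orders at $p$ of the nonzero sections in (the complexification of) $V$. The inflectionary weight is $|p|=\sum_{i=0}^r(o_i-i)$, and the inflection divisor is $\mathrm{Inf}=\sum_{p}|p|\cdot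 p$. The number of real inflection points is the degree $\deg_{\mathbb{R}}$ of the real part $\sum_{p\in X(\mathbb{R})}|p|\cdot p$ of the inflection divisor. *)

theory Defs
  imports
    "HOL-Complex_Analysis.Complex_Analysis"
    "HOL-Computational_Algebra.Computational_Algebra"
    "HOL-Computational_Algebra.Field_as_Ring"
begin

text \<open>
  Throughout, \<open>f\<close> is the right-hand side of the affine equation \<open>y\<^sup>2 = f(x)\<close>, assumed to be
  separable of odd degree \<open>2 * g + 1\<close>; then \<open>g\<close> is the genus of the smooth projective model \<open>X\<close>,
  and \<open>X\<close> has a single point at infinity. A point of \<open>X\<close> is \<open>Some (x, y)\<close> on the affine part,
  and \<open>None\<close> is the point at infinity.
\<close>

type_synonym point = "(complex \<times> complex) option"

definition affine_curve :: "complex poly \<Rightarrow> (complex \<times> complex) set" where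
  "affine_curve f = {(x, y). y ^ 2 = poly f x}"

definition curve_top :: "complex poly \<Rightarrow> point topology" where
  "curve_top f = Alexandroff_compactification (top_of_set (affine_curve f))"

definition curve :: "complex poly \<Rightarrow> point set" where
  "curve f = insert None (Some ` affine_curve f)"

definition conj_affine :: "complex \<times> complex \<Rightarrow> complex \<times> complex" where
  "conj_affine = (\<lambda>(x, y). (cnj x, cnj y))"

definition conj_curve :: "point \<Rightarrow> point" where
  "conj_curve = map_option conj_affine"

definition real_points :: "complex poly \<Rightarrow> point set" where
  "real_points f = {P \<in> curve f. conj_curve P = P}"

definition num_real_components :: "complex poly \<Rightarrow> nat" where
  "num_real_components f =
     card (connected_components_of (subtopology (curve_top f) (real_points f)))"

text \<open>
  A local coordinate at \<open>P\<close>, given by its inverse \<open>\<phi>\<close> on a punctured disc around \<open>0\<close>: an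
  injective holomorphic map to the affine curve tending to \<open>P\<close> in \<open>X\<close>. The puncture allows the
  point at infinity to be treated like all others; by Riemann's removable singularity theorem
  and injectivity, \<open>\<phi>\<close> extends to a biholomorphic map from a disc to a neighbourhood of \<open>P\<close>.
\<close>

definition local_param :: "complex poly \<Rightarrow> point \<Rightarrow> (complex \<Rightarrow> complex \<times> complex) \<Rightarrow> bool" where
  "local_param f P \<phi> \<longleftrightarrow>
     (\<exists>r>0. (\<lambda>t. fst (\<phi> t)) holomorphic_on ball 0 r - {0} \<and>
            (\<lambda>t. snd (\<phi> t)) holomorphic_on ball 0 r - {0} \<and>
            inj_on \<phi> (ball 0 r - {0}) \<and>
            \<phi> ` (ball 0 r - {0}) \<subseteq> affine_curve f) \<and>
     limitin (curve_top f) (\<lambda>t. Some (\<phi> t)) P (at 0)"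

text \<open>
  The function field of \<open>X\<close> is \<open>\<complex>(x) \<oplus> \<complex>(x) y\<close>: the pair \<open>(a, b)\<close> stands for the rational function
  \<open>a(x) + b(x) y\<close>.
\<close>

type_synonym ratfun = "complex poly fract \<times> complex poly fract"

text \<open>
  Evaluation uses coprime numerator and denominator; the values at the finitely many \<open>x\<close> that are
  poles of a coefficient are meaningless, and do not affect orders of vanishing.
\<close>

definition eval_fract :: "complex poly fract \<Rightarrow> complex \<Rightarrow> complex" where
  "eval_fract a x = (case quot_of_fract a of (u, v) \<Rightarrow> poly u x / poly v x)"

definition eval_ratfun :: "ratfun \<Rightarrow> complex \<times> complex \<Rightarrow> complex" where
  "eval_ratfun = (\<lambda>(a, b) (x, y). eval_fract a x + eval_fract b x * y)"

text \<open>
  The order at \<open>P\<close> of a nonzero rational function; it does not depend on the local coordinate.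
\<close>

definition ord_at :: "complex poly \<Rightarrow> point \<Rightarrow> ratfun \<Rightarrow> int" where
  "ord_at f P h = zorder (\<lambda>t. eval_ratfun h ((SOME \<phi>. local_param f P \<phi>) t)) 0"

text \<open>
  Sections of the line bundle \<open>\<L>(E)\<close> of a divisor \<open>E\<close> are identified with rational functions \<open>h\<close>
  such that \<open>div h + E \<ge> 0\<close>. Under this identification \<open>h\<close> vanishes at \<open>P\<close>, as a section, to the
  order \<open>ord\<^sub>P h + E(P)\<close>.
\<close>

type_synonym divisor = "point \<Rightarrow> int"

definition sections :: "complex poly \<Rightarrow> divisor \<Rightarrow> ratfun set" where
  "sections f E = {h. h = 0 \<or> (\<forall>P\<in>curve f. ord_at f P h + E P \<ge> 0)}"

text \<open>
  A rational function \<open>h\<close> is real if \<open>h \<circ> \<sigma> = cnj \<circ> h\<close> for the antiholomorphic involution \<open>\<sigma>\<close>.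
  This can be tested on all affine points, since for \<open>a, b \<in> \<real>(x)\<close> the identity also holds for the
  meaningless values at poles.
\<close>

definition real_ratfun :: "complex poly \<Rightarrow> ratfun \<Rightarrow> bool" where
  "real_ratfun f h \<longleftrightarrow>
     (\<forall>Q\<in>affine_curve f. eval_ratfun h (conj_affine Q) = cnj (eval_ratfun h Q))"

definition real_sections :: "complex poly \<Rightarrow> divisor \<Rightarrow> ratfun set" where
  "real_sections f E = {h \<in> sections f E. real_ratfun f h}"

definition const_mult :: "complex \<Rightarrow> ratfun \<Rightarrow> ratfun" where
  "const_mult c = (\<lambda>(a, b). (to_fract [:c:] * a, to_fract [:c:] * b))"

definition complexification :: "ratfun set \<Rightarrow> ratfun set" where
  "complexification V = {s + const_mult \<i> s' | s s'. s \<in> V \<and> s' \<in> V}"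

definition vanishing_orders :: "complex poly \<Rightarrow> divisor \<Rightarrow> ratfun set \<Rightarrow> point \<Rightarrow> int set" where
  "vanishing_orders f E V P = {ord_at f P s + E P | s. s \<in> complexification V \<and> s \<noteq> 0}"

text \<open>
  For a linear series of dimension \<open>r\<close> there are exactly \<open>r + 1\<close> vanishing orders
  \<open>o\<^sub>0 < \<dots> < o\<^sub>r\<close> at each point; they are listed in increasing order.
\<close>

definition inflection_weight :: "complex poly \<Rightarrow> divisor \<Rightarrow> ratfun set \<Rightarrow> point \<Rightarrow> int" where
  "inflection_weight f E V P =
     (let os = sorted_list_of_set (vanishing_orders f E V P)
      in \<Sum>i<length os. os ! i - int i)"

definition num_real_inflection :: "complex poly \<Rightarrow> divisor \<Rightarrow> ratfun set \<Rightarrow> int" where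
  "num_real_inflection f E V =
     (\<Sum>P | P \<in> real_points f \<and> inflection_weight f E V P \<noteq> 0. inflection_weight f E V P)"

text \<open>The divisor \<open>D = 2 \<cdot> \<infinity>\<close>, the pullback of \<open>\<infinity>\<close> under \<open>(x, y) \<mapsto> x\<close>.\<close>

definition div_D :: divisor where
  "div_D P = (if P = None then 2 else 0)"

end

theory Submission
  imports Defs "Jordan_Normal_Form.Determinant"
begin

text \<open>
  The real Weierstrass points alone account for the bound. The hyperelliptic curve has \<open>2 n\<close> of them: the
  points above the \<open>2 n - 1\<close> real roots of \<open>f\<close>, and the point at infinity. Each has inflectionary weight
  \<open>g (g + 1) / 2\<close>, which adds up to \<open>g (g + 1) n\<close>; all other weights are nonnegative.

  To compute the weights, the sections of \<open>k D\<close> are identified with the functions \<open>P(x) + Q(x) y\<close> for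
  polynomials \<open>P\<close> of degree at most \<open>k\<close> and \<open>Q\<close> of degree less than \<open>k - g\<close>
  (\<open>sections_multiple_of_D\<close>); the real ones among them span the same space over the complex numbers.
  At a Weierstrass point, \<open>x\<close> contributes even orders and \<open>y\<close> an odd one, so the terms \<open>P(x)\<close> and
  \<open>Q(x) y\<close> never cancel and the vanishing orders are \<open>0, 2, \<dots>, 2 k\<close> and \<open>1, 3, \<dots>, 2 (k - g) - 1\<close>
  (\<open>vanishing_orders_branch_point\<close>, \<open>vanishing_orders_infinity\<close>). The orders of \<open>x\<close> and \<open>y\<close> along an
  arbitrary local parameter are found by exhibiting, at each kind of point, a function on the curve that
  is locally injective and therefore has order \<open>1\<close> (\<open>injective_has_ord_1\<close>).

  It remains to see that there are only finitely many inflection points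
  (\<open>finite_inflection_points\<close>). Let \<open>N = 2 k - g + 1\<close> be the dimension of the space of sections. At a
  point \<open>(a, b)\<close> with \<open>b \<noteq> 0\<close>, the first \<open>N\<close> Taylor coefficients of a section in the coordinate
  \<open>(x - a) / b\<^sup>2\<close> depend on the coefficients of the section through an \<open>N \<times> N\<close> matrix whose entries are
  polynomials in \<open>a\<close> (\<open>jets_basis_outside_finite\<close>). Where the matrix is invertible, the vanishing orders
  are \<open>0, \<dots>, N - 1\<close> and the weight is \<open>0\<close>. So it suffices to find one value of \<open>a\<close> where the determinant
  does not vanish, and a root of \<open>f\<close> will do: there the matrix describes the expansions of
  \<open>P(X) + Q(X) sqrt (1 + c X)\<close> with \<open>c \<noteq> 0\<close>. Substituting \<open>s = sqrt (1 + c X)\<close> makes this a polynomial in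
  \<open>s\<close> with at most \<open>N\<close> monomials, which cannot vanish to order \<open>N\<close> at \<open>s = 1\<close>
  (\<open>power_dvd_imp_less_card_support\<close>, \<open>jets_independent_at_branch_point\<close>).
\<close>

section \<open>Orders of meromorphic germs\<close>

text \<open>
  Orders at \<open>0\<close> are read off Laurent expansions. The weak form \<open>ord_ge\<close> also admits the germ that
  vanishes identically, for which \<^const>\<open>zorder\<close> is meaningless; this makes it closed under sums and
  lets a remainder term be estimated without knowing that it is nonzero.
\<close>

definition ord_ge :: "(complex \<Rightarrow> complex) \<Rightarrow> int \<Rightarrow> bool" where
  "ord_ge F m \<longleftrightarrow> (\<exists>L. F has_laurent_expansion L \<and> (\<forall>i<m. fls_nth L i = 0))"

definition has_ord :: "(complex \<Rightarrow> complex) \<Rightarrow> int \<Rightarrow> bool" where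
  "has_ord F m \<longleftrightarrow> (\<exists>L. F has_laurent_expansion L \<and> L \<noteq> 0 \<and> fls_subdegree L = m)"

lemma has_ord_imp_ord_ge: "has_ord F m \<Longrightarrow> ord_ge F m"
  unfolding has_ord_def ord_ge_def using fls_eq0_below_subdegree by blast

lemma ord_ge_mono: "ord_ge F m \<Longrightarrow> m' \<le> m \<Longrightarrow> ord_ge F m'"
  unfolding ord_ge_def by force

lemma has_ord_imp_ord_ge': "has_ord F m \<Longrightarrow> m' \<le> m \<Longrightarrow> ord_ge F m'"
  using has_ord_imp_ord_ge ord_ge_mono by blast

lemma has_ord_zorder: "has_ord F m \<Longrightarrow> zorder F 0 = m"
  unfolding has_ord_def using has_laurent_expansion_zorder_0 by blast

lemma has_ord_unique: "has_ord F m \<Longrightarrow> has_ord F n \<Longrightarrow> m = n"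
  using has_ord_zorder by metis

lemma has_ord_le: "has_ord F m \<Longrightarrow> ord_ge F n \<Longrightarrow> n \<le> m"
  unfolding has_ord_def ord_ge_def
  by (metis has_laurent_expansion_unique nth_fls_subdegree_nonzero not_le_imp_less)

lemma has_ord_eventually_nonzero: "has_ord F m \<Longrightarrow> eventually (\<lambda>t. F t \<noteq> 0) (at 0)"
  unfolding has_ord_def using has_laurent_expansion_nonzero_imp_eventually_nonzero by blast

lemma ord_ge_cases:
  assumes "ord_ge F m"
  obtains (zero) "eventually (\<lambda>t. F t = 0) (at 0)" | (ord) n where "m \<le> n" "has_ord F n"
proof -
  from assms obtain L where L: "F has_laurent_expansion L" "\<forall>i<m. fls_nth L i = 0"
    unfolding ord_ge_def by blast
  show thesis
  proof (cases "L = 0")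
    case True
    then show ?thesis
      using zero has_laurent_expansion_eventually_zero_iff[of F 0 L] L by simp
  next
    case False
    then have "m \<le> fls_subdegree L"
      using L(2) by (meson fls_subdegree_geI)
    then show ?thesis
      using ord L(1) False unfolding has_ord_def by blast
  qed
qed

lemma has_ord_cong:
  "has_ord F m \<Longrightarrow> eventually (\<lambda>t. F t = G t) (at 0) \<Longrightarrow> has_ord G m"
  unfolding has_ord_def using has_laurent_expansion_cong by metis

lemma ord_ge_cong:
  "ord_ge F m \<Longrightarrow> eventually (\<lambda>t. F t = G t) (at 0) \<Longrightarrow> ord_ge G m"
  unfolding ord_ge_def using has_laurent_expansion_cong by metis

lemma has_ord_const: "c \<noteq> 0 \<Longrightarrow> has_ord (\<lambda>_. c) 0"
  unfolding has_ord_def by (intro exI[of _ "fls_const c"]) auto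

lemma ord_ge_0 [simp]: "ord_ge (\<lambda>_. 0) m"
  unfolding ord_ge_def by (intro exI[of _ 0]) auto

lemma ord_ge_const: "ord_ge (\<lambda>_. c) 0"
  by (cases "c = 0") (use has_ord_const has_ord_imp_ord_ge in auto)

lemma has_ord_mult: "has_ord F m \<Longrightarrow> has_ord G n \<Longrightarrow> has_ord (\<lambda>t. F t * G t) (m + n)"
  unfolding has_ord_def by (metis has_laurent_expansion_mult fls_subdegree_mult mult_eq_0_iff)

lemma ord_ge_mult: "ord_ge F m \<Longrightarrow> ord_ge G n \<Longrightarrow> ord_ge (\<lambda>t. F t * G t) (m + n)"
  apply (erule ord_ge_cases)
   apply (rule ord_ge_cong[OF ord_ge_0], erule eventually_mono, simp)
  apply (erule ord_ge_cases[of G])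
   apply (rule ord_ge_cong[OF ord_ge_0], erule eventually_mono, simp)
  using has_ord_imp_ord_ge' has_ord_mult add_mono by blast

lemma has_ord_power: "has_ord F m \<Longrightarrow> has_ord (\<lambda>t. F t ^ n) (int n * m)"
  unfolding has_ord_def by (metis has_laurent_expansion_power fls_subdegree_pow power_not_zero)

lemma has_ord_divide: "has_ord F m \<Longrightarrow> has_ord G n \<Longrightarrow> has_ord (\<lambda>t. F t / G t) (m - n)"
  unfolding has_ord_def by (metis has_laurent_expansion_divide fls_divide_subdegree divide_eq_0_iff)

lemma ord_ge_add: "ord_ge F m \<Longrightarrow> ord_ge G m \<Longrightarrow> ord_ge (\<lambda>t. F t + G t) m"
  unfolding ord_ge_def by (metis has_laurent_expansion_add fls_plus_nth add_0_right)

lemma ord_ge_uminus: "ord_ge F m \<Longrightarrow> ord_ge (\<lambda>t. - F t) m"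
  unfolding ord_ge_def by (metis has_laurent_expansion_minus fls_uminus_nth neg_0_equal_iff_equal)

lemma ord_ge_diff: "ord_ge F m \<Longrightarrow> ord_ge G m \<Longrightarrow> ord_ge (\<lambda>t. F t - G t) m"
  using ord_ge_add[of F m "\<lambda>t. - G t"] ord_ge_uminus[of G m] by simp

lemma has_ord_add:
  assumes "has_ord F m" "ord_ge G n" "m < n"
  shows   "has_ord (\<lambda>t. F t + G t) m"
proof -
  obtain K where K: "F has_laurent_expansion K" "K \<noteq> 0" "fls_subdegree K = m"
    using assms(1) unfolding has_ord_def by blast
  obtain L where L: "G has_laurent_expansion L" "\<forall>i<n. fls_nth L i = 0"
    using assms(2) unfolding ord_ge_def by blast
  have "fls_nth (K + L) m \<noteq> 0"
    using K L(2) \<open>m < n\<close> nth_fls_subdegree_nonzero by auto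
  moreover have "\<forall>i<m. fls_nth (K + L) i = 0"
    using K L(2) \<open>m < n\<close> by auto
  ultimately have "K + L \<noteq> 0" "fls_subdegree (K + L) = m"
    using fls_subdegree_eqI fls_zero_nth by metis+
  with K L show ?thesis
    unfolding has_ord_def by (intro exI[of _ "K + L"]) (auto intro: laurent_expansion_intros)
qed

lemma has_ord_add':
  assumes "has_ord F m" "has_ord G n" "m \<noteq> n"
  shows   "has_ord (\<lambda>t. F t + G t) (min m n)"
proof (cases "m < n")
  case True
  then show ?thesis
    using has_ord_add[OF assms(1) has_ord_imp_ord_ge[OF assms(2)]] by simp
next
  case False
  then have "n < m" using assms(3) by simp
  then show ?thesis
    using has_ord_add[OF assms(2) has_ord_imp_ord_ge[OF assms(1)]] by (simp add: add.commute)
qed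

lemma ord_ge_divide:
  assumes "ord_ge F m" "has_ord G n"
  shows   "ord_ge (\<lambda>t. F t / G t) (m - n)"
  using assms(1)
proof (cases rule: ord_ge_cases)
  case zero
  then show ?thesis
    by (intro ord_ge_cong[OF ord_ge_0]) (erule eventually_mono, simp)
next
  case (ord k)
  then show ?thesis
    using has_ord_divide[OF ord(2) assms(2)] by (intro has_ord_imp_ord_ge') auto
qed

lemma ord_ge_1_iff_tendsto_0:
  assumes "ord_ge F m"
  shows   "ord_ge F 1 \<longleftrightarrow> (F \<longlongrightarrow> 0) (at 0)"
  using assms
proof (cases rule: ord_ge_cases)
  case zero
  then show ?thesis
    by (metis (mono_tags, lifting) ord_ge_0 ord_ge_cong eventually_mono tendsto_eventually)
next
  case (ord n)
  then obtain L where L: "F has_laurent_expansion L" "L \<noteq> 0" "fls_subdegree L = n"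
    unfolding has_ord_def by blast
  have "ord_ge F 1 \<longleftrightarrow> n \<ge> 1"
    using ord(2) has_ord_imp_ord_ge' has_ord_le by blast
  then show ?thesis
    using tendsto_0_subdegree_iff_0[OF L(1,2)] L(3) by auto
qed

text \<open>
  A nonzero limit alone does not determine the order, since a germ with a limit need not be
  meromorphic; the bound \<open>ord_ge F m\<close> supplies meromorphy.
\<close>

lemma has_ord_0I:
  assumes "ord_ge F m" "(F \<longlongrightarrow> c) (at 0)" "c \<noteq> 0"
  shows   "has_ord F 0"
proof -
  have "ord_ge (\<lambda>t. F t - c) (min m 0)"
    by (intro ord_ge_diff ord_ge_mono[OF assms(1)] ord_ge_mono[OF ord_ge_const]) auto
  moreover have "((\<lambda>t. F t - c) \<longlongrightarrow> 0) (at 0)"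
    using assms(2) by (simp add: LIM_zero)
  ultimately have "ord_ge (\<lambda>t. F t - c) 1"
    using ord_ge_1_iff_tendsto_0 by blast
  from has_ord_add[OF has_ord_const[OF assms(3)] this] show ?thesis by simp
qed

text \<open>
  If \<open>F\<close> vanishes identically, \<^const>\<open>zorder\<close> may return anything, but then every lower bound
  holds anyway. So a bound on \<^const>\<open>zorder\<close> is informative as soon as \<open>F\<close> is meromorphic.
\<close>

lemma ord_ge_of_zorder:
  assumes "ord_ge F m" "zorder F 0 \<ge> n"
  shows   "ord_ge F n"
  using assms(1)
proof (cases rule: ord_ge_cases)
  case zero
  then show ?thesis
    by (intro ord_ge_cong[OF ord_ge_0]) (erule eventually_mono, simp)
next
  case (ord k)
  then show ?thesis
    using assms(2) has_ord_zorder has_ord_imp_ord_ge' by blast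
qed

lemma filterlim_at_infinity_has_ord:
  assumes "ord_ge F m" "filterlim F at_infinity (at 0)"
  obtains n where "n > 0" "has_ord F (- n)"
  using assms(1)
proof (cases rule: ord_ge_cases)
  case zero
  then have "(F \<longlongrightarrow> 0) (at 0)"
    by (simp add: tendsto_eventually)
  then show thesis
    using assms(2) not_tendsto_and_filterlim_at_infinity[of "at (0::complex)"] by auto
next
  case (ord n)
  then obtain L where L: "F has_laurent_expansion L" "L \<noteq> 0" "fls_subdegree L = n"
    unfolding has_ord_def by blast
  then have "n < 0"
    using has_laurent_expansion_imp_neg_fls_subdegree[OF L(1) assms(2)] by simp
  then show thesis
    using that[of "- n"] ord(2) by simp
qed

lemma holomorphic_tendsto_ord_ge:
  assumes "F holomorphic_on ball 0 r - {0}" "r > 0" "(F \<longlongrightarrow> c) (at 0)"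
  shows   "ord_ge (\<lambda>t. F t) 0"
proof -
  have "isolated_singularity_at F 0"
    by (metis assms(1,2) isolated_singularity_at_holomorphic open_ball centre_in_ball)
  moreover have "not_essential F 0"
    using assms(3) unfolding not_essential_def by blast
  ultimately obtain L where L: "F has_laurent_expansion L"
    using not_essential_has_laurent_expansion_0 by blast
  have "fls_subdegree L \<ge> 0"
    using L assms(3) has_laurent_expansion_imp_filterlim_infinity_0[OF L]
      not_tendsto_and_filterlim_at_infinity[of "at (0::complex)"] by (meson at_neq_bot not_le)
  then show ?thesis
    unfolding ord_ge_def using L fls_eq0_below_subdegree by (intro exI[of _ L]) auto
qed

lemma holomorphic_filterlim_ord_ge:
  assumes "F holomorphic_on ball 0 r - {0}" "r > 0" "filterlim F at_infinity (at 0)"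
  obtains n where "n > 0" "has_ord F (- n)"
proof -
  have "isolated_singularity_at F 0"
    by (metis assms(1,2) isolated_singularity_at_holomorphic open_ball centre_in_ball)
  moreover have "not_essential F 0"
    using assms(3) unfolding not_essential_def is_pole_def by blast
  ultimately obtain L where L: "F has_laurent_expansion L"
    using not_essential_has_laurent_expansion_0 by blast
  then have "ord_ge F (fls_subdegree L)"
    unfolding ord_ge_def using fls_eq0_below_subdegree by blast
  then show thesis
    using filterlim_at_infinity_has_ord[OF _ assms(3)] that by blast
qed

text \<open>
  An injective map cannot have a vanishing derivative, so an injective germ with value \<open>0\<close> has a
  simple zero. Injectivity is only available on the punctured disc and must first be extended to the
  centre. Local parameters are analysed in this way: at each kind of point some function
  on the curve is injective near the point, and so has order \<open>1\<close> along any parameter.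
\<close>

lemma injective_has_ord_1:
  assumes "ord_ge w 1" "r > 0" "w holomorphic_on ball 0 r - {0}" "inj_on w (ball 0 r - {0})"
  shows   "has_ord w 1"
proof -
  have lim: "(w \<longlongrightarrow> 0) (at 0)"
    using assms(1) ord_ge_1_iff_tendsto_0 by blast
  define h where "h = (\<lambda>t. if t = 0 then 0 else w t)"
  have hlim: "(h \<longlongrightarrow> 0) (at 0)"
    by (rule Lim_transform_eventually[OF lim]) (simp add: h_def eventually_at_filter)
  have h0: "h 0 = 0"
    by (simp add: h_def)
  have "h holomorphic_on ball 0 r - {0}"
    by (rule holomorphic_transform[OF assms(3)]) (simp add: h_def)
  moreover have "(h \<longlongrightarrow> h z) (at z within ball 0 r)" if "z \<in> {0}" for z
  proof -
    from that have "z = 0" by simp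
    then show ?thesis
      using tendsto_within_subset[OF hlim, of "ball 0 r"] h0 by simp
  qed
  ultimately have holo: "h holomorphic_on ball 0 r"
    using no_isolated_singularity'[of "{0}" h "ball 0 r"] by simp
  \<comment> \<open>at most one nonzero point shares the value \<open>0\<close> with the centre; a smaller disc avoids it\<close>
  obtain s where s: "0 < s" "s \<le> r" "\<And>t. t \<in> ball 0 s \<Longrightarrow> t \<noteq> 0 \<Longrightarrow> w t \<noteq> 0"
  proof (cases "\<exists>t\<in>ball 0 r - {0}. w t = 0")
    case True
    then obtain t0 where t0: "t0 \<in> ball 0 r - {0}" "w t0 = 0" by blast
    have "w t \<noteq> 0" if "t \<in> ball 0 (norm t0)" "t \<noteq> 0" for t
    proof
      assume "w t = 0"
      then have "t = t0"
        using inj_onD[OF assms(4), of t t0] t0 that by simp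
      then show False using that by simp
    qed
    then show thesis
      using that[of "norm t0"] t0 by auto
  next
    case False
    then show thesis
      using that[of r] assms(2) by auto
  qed
  have "inj_on h (ball 0 s)"
  proof (rule inj_onI)
    fix x y assume xy: "x \<in> ball 0 s" "y \<in> ball 0 s" "h x = h y"
    show "x = y"
    proof (cases "x = 0 \<or> y = 0")
      case True
      then show ?thesis using xy s(3)[of x] s(3)[of y] by (auto simp: h_def split: if_splits)
    next
      case False
      then show ?thesis
        using xy s(2) inj_onD[OF assms(4), of x y] by (simp add: h_def)
    qed
  qed
  moreover have holo_s: "h holomorphic_on ball 0 s"
    using holo s(2) by (meson holomorphic_on_subset subset_ball)
  ultimately have "deriv h 0 \<noteq> 0"
    using holomorphic_injective_imp_regular[of h "ball 0 s" 0] s(1) by simp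
  then have z: "zorder h 0 = 1"
    using s(1) h0 by (intro zorder_zero_eqI[OF holo_s]) simp_all
  have ev: "eventually (\<lambda>t. h t = w t) (at 0)"
    by (simp add: h_def eventually_at_filter)
  have zw: "zorder w 0 = 1"
    using z zorder_cong[OF ev refl] by metis
  from assms(1) show ?thesis
  proof (cases rule: ord_ge_cases)
    case zero
    moreover have "eventually (\<lambda>t. w t \<noteq> 0) (at 0)"
      using s by (auto simp: eventually_at intro!: exI[of _ s])
    ultimately have "eventually (\<lambda>t::complex. False) (at 0)"
      by eventually_elim simp
    then show ?thesis by simp
  next
    case (ord n)
    then show ?thesis using zw has_ord_zorder by force
  qed
qed

lemma ord_ge_poly:
  assumes "ord_ge u 0"
  shows   "ord_ge (\<lambda>t. poly p (u t)) 0"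
proof (induction p)
  case 0
  then show ?case by simp
next
  case (pCons a p)
  have "ord_ge (\<lambda>t. u t * poly p (u t)) (0 + 0)"
    by (intro ord_ge_mult assms pCons.IH)
  then show ?case
    using ord_ge_add[OF ord_ge_const[of a]] by simp
qed

lemma has_ord_poly_at:
  assumes "has_ord (\<lambda>t. u t - a) e" "e > 0" "p \<noteq> 0"
  shows   "has_ord (\<lambda>t. poly p (u t)) (int (order a p) * e)"
proof -
  obtain q where q: "p = [:-a, 1:] ^ order a p * q" "\<not> [:-a, 1:] dvd q"
    using order_decomp[OF assms(3)] by blast
  have nz: "poly q a \<noteq> 0"
    using q(2) by (simp add: poly_eq_0_iff_dvd)
  have u: "ord_ge (\<lambda>t. u t - a) 1"
    using has_ord_imp_ord_ge'[OF assms(1)] assms(2) by simp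
  then have lim0: "((\<lambda>t. u t - a) \<longlongrightarrow> 0) (at 0)"
    using ord_ge_1_iff_tendsto_0 by blast
  then have lim: "(u \<longlongrightarrow> a) (at 0)"
    by (simp add: LIM_zero_iff)
  have "ord_ge (\<lambda>t. (u t - a) + a) 0"
    by (intro ord_ge_add ord_ge_const ord_ge_mono[OF u]) simp
  then have "ord_ge (\<lambda>t. poly q (u t)) 0"
    using ord_ge_poly[of u q] by simp
  moreover have "((\<lambda>t. poly q (u t)) \<longlongrightarrow> poly q a) (at 0)"
    by (intro tendsto_intros lim)
  ultimately have "has_ord (\<lambda>t. poly q (u t)) 0"
    using has_ord_0I nz by blast
  from has_ord_mult[OF has_ord_power[OF assms(1), of "order a p"] this]
  show ?thesis
    by (subst q(1)) simp
qed

lemma has_ord_poly_pole: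
  assumes "has_ord u (- e)" "e > 0" "p \<noteq> 0"
  shows   "has_ord (\<lambda>t. poly p (u t)) (- (int (degree p) * e))"
  using assms(3)
proof (induction p)
  case 0
  then show ?case by simp
next
  case (pCons a p)
  show ?case
  proof (cases "p = 0")
    case True
    then show ?thesis using pCons.hyps has_ord_const[of a] by simp
  next
    case False
    have "has_ord (\<lambda>t. u t * poly p (u t)) (- e + - (int (degree p) * e))"
      using has_ord_mult[OF assms(1) pCons.IH[OF False]] .
    moreover have "- e + - (int (degree p) * e) < 0"
      using assms(2) by (smt (verit) mult_nonneg_nonneg of_nat_0_le_iff)
    ultimately have "has_ord (\<lambda>t. u t * poly p (u t) + a) (- e + - (int (degree p) * e))"
      using has_ord_add[OF _ ord_ge_const[of a]] by blast
    then show ?thesis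
      using False by (simp add: algebra_simps)
  qed
qed

section \<open>Polynomials with few monomials\<close>

lemma coeff_euler_derivative:
  "coeff ([:0, 1:] * pderiv p - Polynomial.smult (of_nat m) p) i = (of_nat i - of_nat m) * coeff (p :: complex poly) i"
  by (cases i) (simp_all add: coeff_pderiv algebra_simps)

text \<open>
  The operator \<open>X d/dX - m\<close> removes the monomial of degree \<open>m\<close>, keeps all others, and lowers the order of
  vanishing at \<open>1\<close> by at most one. The bound is the one that the Descartes rule of signs gives for real
  polynomials.
\<close>

lemma power_dvd_imp_less_card_support:
  fixes p :: "complex poly"
  assumes "p \<noteq> 0" "[:-1, 1:] ^ n dvd p"
  shows   "n < card {i. coeff p i \<noteq> 0}"
  using assms
proof (induction n arbitrary: p)
  case 0
  have "finite {i. coeff p i \<noteq> 0}"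
    by (rule finite_subset[of _ "{..degree p}"]) (auto simp: le_degree)
  moreover have "degree p \<in> {i. coeff p i \<noteq> 0}"
    using 0 by simp
  ultimately show ?case
    using card_gt_0_iff by blast
next
  case (Suc n)
  define m where "m = degree p"
  define D where "D = [:0, 1:] * pderiv p - Polynomial.smult (of_nat m) p"
  have coeff_D: "coeff D i = (of_nat i - of_nat m) * coeff p i" for i
    unfolding D_def by (rule coeff_euler_derivative)
  have m: "coeff p m \<noteq> 0"
    using Suc.prems(1) by (simp add: m_def)
  have fin: "finite {i. coeff p i \<noteq> 0}"
    by (rule finite_subset[of _ "{..degree p}"]) (auto simp: le_degree)
  have support: "{i. coeff D i \<noteq> 0} = {i. coeff p i \<noteq> 0} - {m}"
    by (auto simp: coeff_D)
  obtain q where q: "p = [:-1, 1:] ^ Suc n * q"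
    using Suc.prems(2) by blast
  have "D = [:-1, 1:] ^ n * ([:0, 1:] * ([:-1, 1:] * pderiv q + Polynomial.smult (of_nat (Suc n)) q)
              - Polynomial.smult (of_nat m) ([:-1, 1:] * q))"
    unfolding D_def q pderiv_mult pderiv_power_Suc
    by (simp add: algebra_simps pderiv_pCons del: mult_pCons_left mult_pCons_right flip: one_pCons)
  then have dvd: "[:-1, 1:] ^ n dvd D"
    by simp
  \<comment> \<open>otherwise \<open>p\<close> would be a single monomial, which has no zero at \<open>1\<close>\<close>
  have "D \<noteq> 0"
  proof
    assume "D = 0"
    then have "coeff p i = 0" if "i \<noteq> m" for i
      using coeff_D[of i] that by simp
    then have "p = monom (coeff p m) m"
      by (intro poly_eqI) (simp add: coeff_monom)
    then have "poly p 1 = coeff p m"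
      by (metis mult.right_neutral poly_monom power_one)
    moreover have "poly p 1 = 0"
      by (simp add: q)
    ultimately show False using m by simp
  qed
  from Suc.IH[OF this dvd] have "n < card ({i. coeff p i \<noteq> 0} - {m})"
    by (simp add: support)
  then show ?case
    using m fin by (simp add: card_Diff_singleton)
qed

section \<open>Linear systems that depend polynomially on a parameter\<close>

definition polynomial_fun :: "(complex \<Rightarrow> complex) \<Rightarrow> bool" where
  "polynomial_fun c \<longleftrightarrow> (\<exists>p. \<forall>a. c a = poly p a)"

lemma polynomial_fun_poly: "polynomial_fun (\<lambda>a. poly p a)"
  unfolding polynomial_fun_def by blast

lemma polynomial_fun_const: "polynomial_fun (\<lambda>_. c)"
  unfolding polynomial_fun_def by (intro exI[of _ "[:c:]"]) simp

lemma polynomial_fun_id: "polynomial_fun (\<lambda>a. a)"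
  unfolding polynomial_fun_def by (intro exI[of _ "[:0, 1:]"]) simp

lemma polynomial_fun_add: "polynomial_fun c \<Longrightarrow> polynomial_fun d \<Longrightarrow> polynomial_fun (\<lambda>a. c a + d a)"
  unfolding polynomial_fun_def by (metis poly_add)

lemma polynomial_fun_diff: "polynomial_fun c \<Longrightarrow> polynomial_fun d \<Longrightarrow> polynomial_fun (\<lambda>a. c a - d a)"
  unfolding polynomial_fun_def by (metis poly_diff)

lemma polynomial_fun_mult: "polynomial_fun c \<Longrightarrow> polynomial_fun d \<Longrightarrow> polynomial_fun (\<lambda>a. c a * d a)"
  unfolding polynomial_fun_def by (metis poly_mult)

lemma polynomial_fun_power: "polynomial_fun c \<Longrightarrow> polynomial_fun (\<lambda>a. c a ^ n)"
  unfolding polynomial_fun_def by (metis poly_power)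

lemma polynomial_fun_divide_const: "polynomial_fun c \<Longrightarrow> polynomial_fun (\<lambda>a. c a / k)"
  using polynomial_fun_mult[OF _ polynomial_fun_const[of "1 / k"]] by simp

lemma polynomial_fun_sum: "(\<And>i. i \<in> I \<Longrightarrow> polynomial_fun (c i)) \<Longrightarrow> polynomial_fun (\<lambda>a. \<Sum>i\<in>I. c i a)"
  by (induction I rule: infinite_finite_induct) (auto intro: polynomial_fun_const polynomial_fun_add)

lemma polynomial_fun_prod: "(\<And>i. i \<in> I \<Longrightarrow> polynomial_fun (c i)) \<Longrightarrow> polynomial_fun (\<lambda>a. \<Prod>i\<in>I. c i a)"
  by (induction I rule: infinite_finite_induct) (auto intro: polynomial_fun_const polynomial_fun_mult)

lemma polynomial_fun_finite_zeros:
  assumes "polynomial_fun c" "c a \<noteq> 0"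
  shows   "finite {x. c x = 0}"
proof -
  obtain p where p: "\<And>x. c x = poly p x"
    using assms(1) unfolding polynomial_fun_def by blast
  with assms(2) have "p \<noteq> 0" by auto
  then show ?thesis
    by (simp add: p poly_roots_finite)
qed

text \<open>
  The determinant is a polynomial in the parameter and is nonzero at \<open>a0\<close>, so it has finitely many
  zeros. This is the role that the Wronskian plays in the theory of inflection points: invertibility
  at a single parameter value, however special, forces invertibility at almost all of them.
\<close>

lemma linear_system_invertible_outside_finite:
  fixes E :: "complex \<Rightarrow> nat \<Rightarrow> nat \<Rightarrow> complex"
  assumes poly: "\<And>i j. polynomial_fun (\<lambda>a. E a i j)"
    and inj: "\<And>v. (\<And>i. i < n \<Longrightarrow> (\<Sum>j<n. E a0 i j * v j) = 0) \<Longrightarrow> (\<And>j. j < n \<Longrightarrow> v j = 0)"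
  obtains A where "finite A"
    and "\<And>a v j. a \<notin> A \<Longrightarrow> (\<And>i. i < n \<Longrightarrow> (\<Sum>j<n. E a i j * v j) = 0) \<Longrightarrow> j < n \<Longrightarrow> v j = 0"
    and "\<And>a w. a \<notin> A \<Longrightarrow> \<exists>v. \<forall>i<n. (\<Sum>j<n. E a i j * v j) = w i"
proof -
  define M where "M a = mat n n (\<lambda>(i, j). E a i j)" for a
  have M: "M a \<in> carrier_mat n n" for a
    by (simp add: M_def)
  have mult: "(M a *\<^sub>v v) $ i = (\<Sum>j<n. E a i j * v $ j)" if "v \<in> carrier_vec n" "i < n" for a v i
    using that by (simp add: M_def scalar_prod_def atLeast0LessThan)
  have "polynomial_fun (\<lambda>a. det (M a))"
    unfolding det_def'[OF M]
  proof (intro polynomial_fun_sum polynomial_fun_mult polynomial_fun_const polynomial_fun_prod)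
    fix p i assume "p \<in> {p. p permutes {0..<n}}" "i \<in> {0..<n}"
    then have "p i < n" "i < n"
      using permutes_in_image[of p "{0..<n}" i] by auto
    then show "polynomial_fun (\<lambda>a. M a $$ (i, p i))"
      using poly by (simp add: M_def)
  qed
  moreover have "det (M a0) \<noteq> 0"
  proof
    assume "det (M a0) = 0"
    then obtain v where v: "v \<in> carrier_vec n" "v \<noteq> 0\<^sub>v n" "M a0 *\<^sub>v v = 0\<^sub>v n"
      using det_0_iff_vec_prod_zero_field[OF M] by blast
    have "(\<Sum>j<n. E a0 i j * v $ j) = 0" if "i < n" for i
      using mult[OF v(1) that, of a0] v(3) that by simp
    then have "v $ j = 0" if "j < n" for j
      using inj that by blast
    with v(1,2) show False
      by (metis carrier_vecD eq_vecI index_zero_vec)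
  qed
  ultimately have fin: "finite {a. det (M a) = 0}"
    by (rule polynomial_fun_finite_zeros)
  have 1: "v j = 0" if "det (M a) \<noteq> 0" "\<And>i. i < n \<Longrightarrow> (\<Sum>j<n. E a i j * v j) = 0" "j < n" for a v j
  proof -
    have "M a *\<^sub>v vec n v = 0\<^sub>v n"
    proof (rule eq_vecI)
      fix i assume "i < dim_vec (0\<^sub>v n :: complex vec)"
      then have "i < n" by simp
      then show "(M a *\<^sub>v vec n v) $ i = 0\<^sub>v n $ i"
        using that(2) by (subst mult) simp_all
    qed (simp add: M_def)
    then have "vec n v = 0\<^sub>v n"
      using det_0_iff_vec_prod_zero_field[OF M, of a] that(1) vec_carrier by blast
    then show ?thesis
      using that(3) by (metis index_vec index_zero_vec(1))
  qed
  have 2: "\<exists>v. \<forall>i<n. (\<Sum>j<n. E a i j * v j) = w i" if det: "det (M a) \<noteq> 0" for a w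
  proof -
    obtain B where B: "B \<in> carrier_mat n n" "M a * B = 1\<^sub>m n"
      using det_non_zero_imp_unit[OF M det, of "()"] unfolding Units_def ring_mat_def by auto
    define u where "u = B *\<^sub>v vec n w"
    have u: "u \<in> carrier_vec n"
      using B(1) unfolding u_def by simp
    have "M a *\<^sub>v u = vec n w"
      unfolding u_def using B M[of a] by (simp flip: assoc_mult_mat_vec)
    then have "(\<Sum>j<n. E a i j * u $ j) = w i" if "i < n" for i
      using mult[OF u that, of a] that by simp
    then show ?thesis
      by (intro exI[of _ "\<lambda>j. u $ j"]) simp
  qed
  show thesis
    using that[OF fin] 1 2 by blast
qed

section \<open>Truncated square roots of the defining polynomial\<close>

text \<open>
  The coefficients of the power series with constant term \<open>1\<close> whose square is \<open>\<Sum>n. F n X^n\<close>, for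
  \<open>F 0 = 1\<close>. The recursion only divides by \<open>2\<close>, so the coefficients are polynomials in those of the square.
\<close>

fun sqrt_coeff :: "(nat \<Rightarrow> complex) \<Rightarrow> nat \<Rightarrow> complex" where
  "sqrt_coeff F n =
     (if n = 0 then 1 else (F n - (\<Sum>i\<in>{1..<n}. sqrt_coeff F i * sqrt_coeff F (n - i))) / 2)"

declare sqrt_coeff.simps [simp del]

lemma sqrt_coeff_0 [simp]: "sqrt_coeff F 0 = 1"
  by (simp add: sqrt_coeff.simps)

lemma sqrt_coeff_convolution:
  assumes "F 0 = 1"
  shows   "(\<Sum>i\<le>n. sqrt_coeff F i * sqrt_coeff F (n - i)) = F n"
proof (cases "n = 0")
  case True
  then show ?thesis using assms by simp
next
  case False
  have "{..n} = insert 0 (insert n {1..<n})" using False by auto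
  then have "(\<Sum>i\<le>n. sqrt_coeff F i * sqrt_coeff F (n - i)) =
               2 * sqrt_coeff F n + (\<Sum>i\<in>{1..<n}. sqrt_coeff F i * sqrt_coeff F (n - i))"
    using False by simp
  also have "2 * sqrt_coeff F n = F n - (\<Sum>i\<in>{1..<n}. sqrt_coeff F i * sqrt_coeff F (n - i))"
    using False by (subst sqrt_coeff.simps) simp
  finally show ?thesis by simp
qed

lemma polynomial_fun_sqrt_coeff:
  assumes "\<And>m. polynomial_fun (\<lambda>a. F a m)"
  shows   "polynomial_fun (\<lambda>a. sqrt_coeff (F a) n)"
proof (induction n rule: less_induct)
  case (less n)
  show ?case
  proof (cases "n = 0")
    case True
    then show ?thesis by (simp add: polynomial_fun_const)
  next
    case False
    have "polynomial_fun (\<lambda>a. (F a n - (\<Sum>i\<in>{1..<n}. sqrt_coeff (F a) i * sqrt_coeff (F a) (n - i))) / 2)"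
      by (intro polynomial_fun_divide_const polynomial_fun_diff polynomial_fun_sum
            polynomial_fun_mult less.IH assms) auto
    moreover have "sqrt_coeff (F a) n =
        (F a n - (\<Sum>i\<in>{1..<n}. sqrt_coeff (F a) i * sqrt_coeff (F a) (n - i))) / 2" for a
      using False by (subst sqrt_coeff.simps) simp
    ultimately show ?thesis by presburger
  qed
qed

text \<open>
  Induction on \<open>f\<close> avoids divided higher derivatives: passing from \<open>f\<close> to \<open>c + x f\<close> combines two
  neighbouring Taylor coefficients with coefficients \<open>1\<close> and \<open>a\<close>.
\<close>

lemma polynomial_fun_taylor_coeff: "polynomial_fun (\<lambda>a. coeff (pcompose f [:a, 1:]) m)"
proof (induction f arbitrary: m)
  case 0
  then show ?case by (simp add: polynomial_fun_const)
next
  case (pCons c f)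
  have eq: "coeff (pcompose (pCons c f) [:a, 1:]) m =
          (if m = 0 then c else coeff (pcompose f [:a, 1:]) (m - 1)) + a * coeff (pcompose f [:a, 1:]) m" for a
    by (cases m) (simp_all add: pcompose_pCons coeff_pCons)
  have "polynomial_fun (\<lambda>a. if m = 0 then c else coeff (pcompose f [:a, 1:]) (m - 1))"
    by (cases "m = 0") (use polynomial_fun_const[of c] pCons.IH[of "m - 1"] in simp_all)
  then show ?case
    unfolding eq
    by (intro polynomial_fun_add polynomial_fun_mult polynomial_fun_id pCons.IH)
qed

text \<open>
  The coefficients of \<open>f(a + f(a) X) / f(a)\<close>. At a point \<open>(a, b)\<close> with \<open>b \<noteq> 0\<close> the rescaled
  coordinate \<open>X = (x - a) / b\<^sup>2\<close> turns \<open>(y / b)\<^sup>2\<close> into this series. The rescaling makes the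
  coefficients polynomial in \<open>a\<close>, and thereby meaningful also at the roots of \<open>f\<close>, where the series
  degenerates to \<open>1 + f'(a) X\<close>.
\<close>

definition scaled_taylor_coeff :: "complex poly \<Rightarrow> complex \<Rightarrow> nat \<Rightarrow> complex" where
  "scaled_taylor_coeff f a m =
     (if m = 0 then 1 else coeff (pcompose f [:a, 1:]) m * poly f a ^ (m - 1))"

text \<open>
  The expansion of \<open>y / b\<close> in \<open>X\<close>, cut off at \<open>X^N\<close>.
\<close>

definition sqrt_jet :: "complex poly \<Rightarrow> nat \<Rightarrow> complex \<Rightarrow> complex poly" where
  "sqrt_jet f N a = (\<Sum>m<N. monom (sqrt_coeff (scaled_taylor_coeff f a) m) m)"

lemma coeff_sqrt_jet:
  "coeff (sqrt_jet f N a) m = (if m < N then sqrt_coeff (scaled_taylor_coeff f a) m else 0)"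
  by (simp add: sqrt_jet_def coeff_sum)

lemma coeff_sqrt_jet_square:
  assumes "m < N"
  shows   "coeff (sqrt_jet f N a ^ 2) m = scaled_taylor_coeff f a m"
proof -
  have "coeff (sqrt_jet f N a ^ 2) m =
          (\<Sum>i\<le>m. sqrt_coeff (scaled_taylor_coeff f a) i * sqrt_coeff (scaled_taylor_coeff f a) (m - i))"
    unfolding power2_eq_square coeff_mult using assms by (intro sum.cong) (auto simp: coeff_sqrt_jet)
  also have "\<dots> = scaled_taylor_coeff f a m"
    by (rule sqrt_coeff_convolution) (simp add: scaled_taylor_coeff_def)
  finally show ?thesis .
qed

lemma sqrt_jet_approximates:
  assumes "b ^ 2 = poly f a"
  shows   "monom 1 N dvd pcompose f [:a, b ^ 2:] - Polynomial.smult (b ^ 2) (sqrt_jet f N a ^ 2)"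
  unfolding monom_1_dvd_iff'
proof (intro allI impI)
  fix m assume "m < N"
  have "pcompose f [:a, b ^ 2:] = pcompose (pcompose f [:a, 1:]) [:0, b ^ 2:]"
    by (simp flip: pcompose_assoc add: pcompose_pCons)
  then have "coeff (pcompose f [:a, b ^ 2:]) m = (b ^ 2) ^ m * coeff (pcompose f [:a, 1:]) m"
    by (simp only: coeff_pcompose_linear)
  also have "\<dots> = b ^ 2 * scaled_taylor_coeff f a m"
    using assms by (cases m) (simp_all add: scaled_taylor_coeff_def)
  finally show "coeff (pcompose f [:a, b ^ 2:] - Polynomial.smult (b ^ 2) (sqrt_jet f N a ^ 2)) m = 0"
    using coeff_sqrt_jet_square[OF \<open>m < N\<close>] by simp
qed

lemma coeff_pcompose_square:
  "coeff (pcompose p [:0, 0, 1:]) n = (if even n then coeff (p :: complex poly) (n div 2) else 0)"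
proof (induction p arbitrary: n)
  case 0
  then show ?case by simp
next
  case (pCons c p)
  show ?case
  proof (cases n)
    case 0
    then show ?thesis by (simp add: pcompose_pCons)
  next
    case (Suc m)
    then show ?thesis
      by (cases m) (auto simp: pcompose_pCons pCons.IH coeff_pCons)
  qed
qed

text \<open>
  The monomials of \<open>P(s\<^sup>2)\<close> and \<open>s Q(s\<^sup>2)\<close> are separated by parity, so their number is at most the
  number of coefficients of \<open>P\<close> and \<open>Q\<close>, and nothing cancels.
\<close>

lemma even_odd_parts_support:
  fixes P Q :: "complex poly"
  assumes "degree P \<le> k" "degree Q < d"
  defines "T \<equiv> pcompose P [:0, 0, 1:] + [:0, 1:] * pcompose Q [:0, 0, 1:]"
  shows   "card {i. coeff T i \<noteq> 0} \<le> k + 1 + d" "T = 0 \<Longrightarrow> P = 0 \<and> Q = 0"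
proof -
  have even: "coeff T (2 * i) = coeff P i" for i
    by (cases i) (simp_all add: T_def coeff_pcompose_square coeff_pCons poly_0_coeff_0)
  have odd: "coeff T (2 * i + 1) = coeff Q i" for i
    by (simp add: T_def coeff_pcompose_square)
  have "{i. coeff T i \<noteq> 0} \<subseteq> (\<lambda>i. 2 * i) ` {..k} \<union> (\<lambda>i. 2 * i + 1) ` {..<d}"
  proof
    fix i assume i: "i \<in> {i. coeff T i \<noteq> 0}"
    show "i \<in> (\<lambda>i. 2 * i) ` {..k} \<union> (\<lambda>i. 2 * i + 1) ` {..<d}"
    proof (cases "even i")
      case True
      then obtain j where j: "i = 2 * j" by blast
      then have "j \<le> degree P" using i even[of j] by (simp add: le_degree)
      then show ?thesis using assms(1) j by simp
    next
      case False
      then obtain j where j: "i = 2 * j + 1" by (elim oddE)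
      then have "j \<le> degree Q" using i odd[of j] by (simp add: le_degree)
      then show ?thesis using assms(2) j by simp
    qed
  qed
  then have "card {i. coeff T i \<noteq> 0} \<le> card ((\<lambda>i. 2 * i) ` {..k} \<union> (\<lambda>i. 2 * i + 1) ` {..<d})"
    by (intro card_mono) auto
  also have "\<dots> \<le> card ((\<lambda>i. 2 * i) ` {..k}) + card ((\<lambda>i. 2 * i + 1) ` {..<d})"
    by (rule card_Un_le)
  also have "\<dots> \<le> k + 1 + d"
    using card_image_le[of "{..k}" "\<lambda>i. 2 * i"] card_image_le[of "{..<d}" "\<lambda>i. 2 * i + 1"] by simp
  finally show "card {i. coeff T i \<noteq> 0} \<le> k + 1 + d" .
  show "P = 0 \<and> Q = 0" if "T = 0"
  proof
    show "P = 0" by (rule poly_eqI) (use even that in simp)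
    show "Q = 0" by (rule poly_eqI) (use odd that in simp)
  qed
qed

lemma pcompose_power: "pcompose (p ^ n) r = pcompose p r ^ n" for p r :: "complex poly"
  by (induction n) (simp_all add: pcompose_mult one_pCons)

lemma dvd_power_mult_nonroot:
  fixes p q :: "complex poly"
  assumes "[:- a, 1:] ^ n dvd p * q" "poly q a \<noteq> 0"
  shows   "[:- a, 1:] ^ n dvd p"
proof (cases "p = 0")
  case False
  have "q \<noteq> 0" using assms(2) by auto
  then show ?thesis
    using assms False unfolding order_divides by (simp add: order_mult order_0I)
qed simp

text \<open>
  At a simple root of \<open>f\<close> the truncated square root is that of \<open>1 + c X\<close> with \<open>c \<noteq> 0\<close>. In terms of
  \<open>s = sqrt (1 + c X)\<close> the function \<open>P + Q sqrt (1 + c X)\<close> becomes a polynomial in \<open>s\<close> with at most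
  \<open>k + 1 + d\<close> monomials, which cannot vanish to that order at \<open>s = 1\<close> unless it is zero.
\<close>

lemma jets_independent_at_branch_point:
  fixes f P Q :: "complex poly"
  assumes root: "poly f a = 0" and c: "coeff (pcompose f [:a, 1:]) 1 \<noteq> 0"
    and deg: "degree P \<le> k" "degree Q < d"
    and vanish: "monom 1 (k + 1 + d) dvd P + Q * sqrt_jet f (k + 1 + d) a"
  shows   "P = 0 \<and> Q = 0"
proof -
  define c where "c = coeff (pcompose f [:a, 1:]) 1"
  define N where "N = k + 1 + d"
  define S where "S = sqrt_jet f N a"
  \<comment> \<open>substituting \<open>(s\<^sup>2 - 1) / c\<close> for the variable turns \<open>sqrt (1 + c X)\<close> into \<open>s\<close>\<close>
  define r where "r = [:- 1 / c, 0, 1 / c:]"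
  define \<sigma> where "\<sigma> = pcompose S r"
  have c0: "c \<noteq> 0" using c by (simp add: c_def)
  have "r = [:-1, 1:] * [:1 / c, 1 / c:]"
    by (simp add: r_def)
  then have "[:-1, 1:] dvd r" by (metis dvd_triv_left)
  then have "[:-1, 1:] ^ N dvd r ^ N" by (rule dvd_power_same)
  moreover have "pcompose (monom 1 N) r = r ^ N"
    by (simp add: monom_altdef pcompose_power pcompose_pCons)
  ultimately have transfer: "[:-1, 1:] ^ N dvd pcompose p r" if "monom 1 N dvd p" for p
    using that by (elim dvdE) (simp add: pcompose_mult)
  have "monom 1 N dvd S ^ 2 - [:1, c:]"
    unfolding monom_1_dvd_iff'
  proof (intro allI impI)
    fix m assume "m < N"
    have "scaled_taylor_coeff f a m = coeff [:1, c:] m"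
      by (cases m) (auto simp: scaled_taylor_coeff_def root c_def coeff_pCons split: nat.splits)
    then show "coeff (S ^ 2 - [:1, c:]) m = 0"
      using coeff_sqrt_jet_square[OF \<open>m < N\<close>] by (simp add: S_def)
  qed
  from transfer[OF this] have "[:-1, 1:] ^ N dvd \<sigma> ^ 2 - pcompose [:1, c:] r"
    by (simp add: \<sigma>_def pcompose_diff pcompose_power)
  also have "pcompose [:1, c:] r = [:0, 1:] ^ 2"
    using c0 by (simp add: r_def pcompose_pCons power2_eq_square)
  also have "\<sigma> ^ 2 - [:0, 1:] ^ 2 = (\<sigma> - [:0, 1:]) * (\<sigma> + [:0, 1:])"
    by (simp add: power2_eq_square algebra_simps)
  finally have "[:-1, 1:] ^ N dvd (\<sigma> - [:0, 1:]) * (\<sigma> + [:0, 1:])" .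
  \<comment> \<open>\<open>\<sigma>\<close> is congruent to \<open>s\<close> and not to \<open>- s\<close>, by its value at \<open>s = 1\<close>\<close>
  moreover have "poly \<sigma> 1 = 1"
    by (simp add: \<sigma>_def poly_pcompose r_def poly_0_coeff_0 S_def coeff_sqrt_jet N_def)
  then have "poly (\<sigma> + [:0, 1:]) 1 \<noteq> 0" by simp
  ultimately have \<sigma>: "[:-1, 1:] ^ N dvd \<sigma> - [:0, 1:]"
    using dvd_power_mult_nonroot by blast
  define P1 where "P1 = pcompose P [:- 1 / c, 1 / c:]"
  define Q1 where "Q1 = pcompose Q [:- 1 / c, 1 / c:]"
  define T where "T = pcompose P1 [:0, 0, 1:] + [:0, 1:] * pcompose Q1 [:0, 0, 1:]"
  have deg1: "degree P1 \<le> k" "degree Q1 < d"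
    using deg by (simp_all add: P1_def Q1_def degree_pcompose)
  have "pcompose [:- 1 / c, 1 / c:] [:0, 0, 1:] = r"
    by (simp add: r_def pcompose_pCons)
  then have "pcompose P1 [:0, 0, 1:] = pcompose P r" "pcompose Q1 [:0, 0, 1:] = pcompose Q r"
    by (simp_all add: P1_def Q1_def flip: pcompose_assoc)
  then have T: "T = pcompose (P + Q * S) r - (\<sigma> - [:0, 1:]) * pcompose Q r"
    by (simp add: T_def \<sigma>_def pcompose_add pcompose_mult algebra_simps)
  have "[:-1, 1:] ^ N dvd T"
    unfolding T
  proof (rule dvd_diff)
    show "[:-1, 1:] ^ N dvd pcompose (P + Q * S) r"
      using transfer vanish by (simp only: S_def N_def)
    show "[:-1, 1:] ^ N dvd (\<sigma> - [:0, 1:]) * pcompose Q r"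
      using \<sigma> by (rule dvd_mult2)
  qed
  then have "T = 0"
    using power_dvd_imp_less_card_support[of T N] even_odd_parts_support(1)[OF deg1]
    by (auto simp: T_def N_def)
  then have "P1 = 0 \<and> Q1 = 0"
    using even_odd_parts_support(2)[OF deg1] by (simp add: T_def)
  then show ?thesis
    using c0 by (simp add: P1_def Q1_def pcompose_eq_0_iff)
qed

lemma sum_lessThan_add: "(\<Sum>j<m + n. h j) = (\<Sum>j<m. h j) + (\<Sum>j<n. h (m + j))"
  for h :: "nat \<Rightarrow> complex" and m n :: nat
  by (induction n) (simp_all add: add.assoc)

text \<open>
  The \<open>N = k + 1 + d\<close> coefficients of \<open>P\<close> and \<open>Q\<close> are mapped linearly to the first \<open>N\<close> Taylor
  coefficients of \<open>P + Q y / b\<close> at \<open>(a, b)\<close>, by a square matrix polynomial in \<open>a\<close>. It is invertible at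
  the root \<open>a0\<close> of \<open>f\<close>, hence at almost every \<open>a\<close>.
\<close>

lemma jets_basis_outside_finite:
  fixes f :: "complex poly" and k d :: nat
  assumes "poly f a0 = 0" "coeff (pcompose f [:a0, 1:]) 1 \<noteq> 0" "d > 0"
  defines "N \<equiv> k + 1 + d"
  obtains A where "finite A"
    and "\<And>a P Q. a \<notin> A \<Longrightarrow> degree P \<le> k \<Longrightarrow> degree Q < d \<Longrightarrow>
            monom 1 N dvd P + Q * sqrt_jet f N a \<Longrightarrow> P = 0 \<and> Q = 0"
    and "\<And>a w. a \<notin> A \<Longrightarrow> \<exists>P Q. degree P \<le> k \<and> degree Q < d \<and>
            (\<forall>i<N. coeff (P + Q * sqrt_jet f N a) i = w i)"
proof -
  \<comment> \<open>the unknowns \<open>j \<le> k\<close> are the coefficients of \<open>P\<close>, the remaining ones those of \<open>Q\<close>\<close>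
  define E where "E a i j = (if j \<le> k then (if i = j then 1 else 0)
      else if j - (k + 1) \<le> i then sqrt_coeff (scaled_taylor_coeff f a) (i - (j - (k + 1))) else 0)"
    for a i j
  define pol1 where "pol1 v = (\<Sum>j<k + 1. monom (v j) j)" for v :: "nat \<Rightarrow> complex"
  define pol2 where "pol2 v = (\<Sum>j<d. monom (v (k + 1 + j)) j)" for v :: "nat \<Rightarrow> complex"
  have coeff1: "coeff (pol1 v) i = (if i < k + 1 then v i else 0)" for v i
    by (simp add: pol1_def coeff_sum)
  have coeff2: "coeff (pol2 v) i = (if i < d then v (k + 1 + i) else 0)" for v i
    by (simp add: pol2_def coeff_sum)
  have deg1: "degree (pol1 v) \<le> k" for v
    by (rule degree_le) (simp add: coeff1)
  have deg2: "degree (pol2 v) < d" for v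
    using degree_le[of "d - 1" "pol2 v"] \<open>d > 0\<close> by (force simp: coeff2)
  have E: "(\<Sum>j<N. E a i j * v j) = coeff (pol1 v + pol2 v * sqrt_jet f N a) i" if "i < N" for a v i
  proof -
    have "(\<Sum>j<N. E a i j * v j) = (\<Sum>j<k + 1. E a i j * v j) + (\<Sum>j<d. E a i (k + 1 + j) * v (k + 1 + j))"
      unfolding N_def by (rule sum_lessThan_add)
    also have "(\<Sum>j<k + 1. E a i j * v j) = (\<Sum>j<k + 1. if j = i then v j else 0)"
      by (intro sum.cong) (auto simp: E_def)
    also have "\<dots> = coeff (pol1 v) i"
      by (simp add: coeff1)
    also have "(\<Sum>j<d. E a i (k + 1 + j) * v (k + 1 + j)) =
               (\<Sum>j<d. if j \<le> i then coeff (pol2 v) j * coeff (sqrt_jet f N a) (i - j) else 0)"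
      using that by (intro sum.cong) (auto simp: E_def coeff2 coeff_sqrt_jet)
    also have "\<dots> = (\<Sum>j\<in>{..i} \<inter> {..<d}. coeff (pol2 v) j * coeff (sqrt_jet f N a) (i - j))"
      by (intro sum.mono_neutral_cong_right) auto
    also have "\<dots> = (\<Sum>j\<le>i. coeff (pol2 v) j * coeff (sqrt_jet f N a) (i - j))"
      by (intro sum.mono_neutral_cong_left) (auto simp: coeff2)
    finally show ?thesis
      by (simp add: coeff_mult)
  qed
  have pol_zero: "v j = 0" if "pol1 v = 0" "pol2 v = 0" "j < N" for v j
  proof (cases "j < k + 1")
    case True
    then show ?thesis using coeff1[of v j] that(1) by simp
  next
    case False
    then have "j - (k + 1) < d" "k + 1 + (j - (k + 1)) = j"
      using that(3) by (auto simp: N_def)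
    then show ?thesis using coeff2[of v "j - (k + 1)"] that(2) by (metis coeff_0)
  qed
  have ent: "polynomial_fun (\<lambda>a. E a i j)" for i j
  proof -
    have "polynomial_fun (\<lambda>a. scaled_taylor_coeff f a m)" for m
      by (cases "m = 0")
         (auto simp: scaled_taylor_coeff_def intro!: polynomial_fun_const polynomial_fun_mult
            polynomial_fun_taylor_coeff polynomial_fun_power polynomial_fun_poly)
    then have "polynomial_fun (\<lambda>a. sqrt_coeff (scaled_taylor_coeff f a) m)" for m
      by (rule polynomial_fun_sqrt_coeff)
    then show ?thesis
      unfolding E_def
      by (cases "j \<le> k"; cases "i = j"; cases "j - (k + 1) \<le> i") (simp_all add: polynomial_fun_const)
  qed
  have inj0: "v j = 0" if "\<And>i. i < N \<Longrightarrow> (\<Sum>j<N. E a0 i j * v j) = 0" "j < N" for v j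
  proof -
    have "monom 1 N dvd pol1 v + pol2 v * sqrt_jet f N a0"
      unfolding monom_1_dvd_iff' using that(1) E by simp
    then have "pol1 v = 0 \<and> pol2 v = 0"
      using jets_independent_at_branch_point[OF assms(1,2) deg1 deg2] by (simp add: N_def)
    then show ?thesis using pol_zero that(2) by blast
  qed
  obtain A where A: "finite A"
    "\<And>a v j. a \<notin> A \<Longrightarrow> (\<And>i. i < N \<Longrightarrow> (\<Sum>j<N. E a i j * v j) = 0) \<Longrightarrow> j < N \<Longrightarrow> v j = 0"
    "\<And>a w. a \<notin> A \<Longrightarrow> \<exists>v. \<forall>i<N. (\<Sum>j<N. E a i j * v j) = w i"
    using linear_system_invertible_outside_finite[of E N a0] ent inj0 by blast
  show thesis
  proof (rule that[OF A(1)])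
    fix a P Q assume *: "a \<notin> A" "degree P \<le> k" "degree Q < d" "monom 1 N dvd P + Q * sqrt_jet f N a"
    define v where "v j = (if j < k + 1 then coeff P j else coeff Q (j - (k + 1)))" for j
    have P: "pol1 v = P"
      using *(2) by (intro poly_eqI) (auto simp: coeff1 v_def coeff_eq_0)
    have Q: "pol2 v = Q"
      using *(3) by (intro poly_eqI) (auto simp: coeff2 v_def coeff_eq_0)
    have "(\<Sum>j<N. E a i j * v j) = 0" if "i < N" for i
      using *(4) that unfolding E[OF that] P Q monom_1_dvd_iff' by blast
    then have v0: "v j = 0" if "j < N" for j
      using A(2)[OF *(1), of v] that by blast
    have "pol1 v = 0" "pol2 v = 0"
      unfolding pol1_def pol2_def by (intro sum.neutral ballI; simp add: v0 N_def)+
    then show "P = 0 \<and> Q = 0" using P Q by simp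
  next
    fix a w assume "a \<notin> A"
    then obtain v where "\<forall>i<N. (\<Sum>j<N. E a i j * v j) = w i"
      using A(3) by blast
    then show "\<exists>P Q. degree P \<le> k \<and> degree Q < d \<and> (\<forall>i<N. coeff (P + Q * sqrt_jet f N a) i = w i)"
      using deg1 deg2 E by (intro exI[of _ "pol1 v"] exI[of _ "pol2 v"]) simp
  qed
qed

section \<open>Convergence on the compactified curve\<close>

lemma limitin_curve_top_Some:
  assumes "eventually (\<lambda>t. \<phi> t \<in> affine_curve f) F"
  shows   "limitin (curve_top f) (\<lambda>t. Some (\<phi> t)) (Some Q) F \<longleftrightarrow> Q \<in> affine_curve f \<and> (\<phi> \<longlongrightarrow> Q) F"
proof
  assume L: "limitin (curve_top f) (\<lambda>t. Some (\<phi> t)) (Some Q) F"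
  then have Q: "Q \<in> affine_curve f"
    unfolding limitin_def curve_top_def by auto
  have "(\<phi> \<longlongrightarrow> Q) F"
  proof (rule topological_tendstoI)
    fix U assume U: "open U" "Q \<in> U"
    have "openin (curve_top f) (Some ` (affine_curve f \<inter> U))"
      unfolding curve_top_def using U(1) by (simp add: openin_open_Int)
    from limitinD[OF L this] Q U(2) show "eventually (\<lambda>t. \<phi> t \<in> U) F"
      by (auto elim!: eventually_mono)
  qed
  with Q show "Q \<in> affine_curve f \<and> (\<phi> \<longlongrightarrow> Q) F" ..
next
  assume "Q \<in> affine_curve f \<and> (\<phi> \<longlongrightarrow> Q) F"
  then have "limitin (top_of_set (affine_curve f)) \<phi> Q F"
    using assms by (simp add: limitin_subtopology)
  from continuous_map_limit[OF continuous_map_Some this]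
  show "limitin (curve_top f) (\<lambda>t. Some (\<phi> t)) (Some Q) F"
    by (simp add: curve_top_def o_def)
qed

lemma closed_affine_curve: "closed (affine_curve f)"
proof -
  have "affine_curve f = {z. snd z ^ 2 = poly f (fst z)}"
    by (auto simp: affine_curve_def)
  then show ?thesis
    by (simp add: closed_Collect_eq continuous_intros)
qed

text \<open>
  The projection \<open>(x, y) \<mapsto> x\<close> is proper, since \<open>y\<close> is bounded in terms of \<open>f(x)\<close>. Hence leaving every
  compact subset of the affine curve just means \<open>x \<rightarrow> \<infinity>\<close>.
\<close>

lemma compact_affine_curve_part: "compact {z \<in> affine_curve f. norm (fst z) \<le> R}"
proof -
  have "closed (affine_curve f \<inter> {z. norm (fst z) \<le> R})"
    by (intro closed_Int closed_affine_curve closed_Collect_le continuous_intros)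
  moreover have "bounded (affine_curve f \<inter> {z. norm (fst z) \<le> R})"
  proof -
    have "compact (poly f ` cball 0 R)"
      by (intro compact_continuous_image continuous_intros) auto
    then obtain B where B: "\<And>x. x \<in> cball 0 R \<Longrightarrow> norm (poly f x) \<le> B"
      using compact_imp_bounded bounded_iff by (metis imageI)
    have "norm y \<le> 1 + B" if "y ^ 2 = poly f x" "norm x \<le> R" for x y
    proof -
      have "norm y ^ 2 \<le> B"
        using B[of x] that by (simp flip: norm_power)
      moreover have "norm y \<le> 1 + norm y ^ 2"
        using zero_le_power2[of "norm y - 1 / 2"] by (simp add: power2_eq_square algebra_simps)
      ultimately show ?thesis by simp
    qed
    then have "affine_curve f \<inter> {z. norm (fst z) \<le> R} \<subseteq> cball 0 R \<times> cball 0 (1 + B)"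
      by (auto simp: affine_curve_def)
    then show ?thesis
      by (rule bounded_subset[rotated]) (intro bounded_Times bounded_cball)
  qed
  ultimately show ?thesis
    by (simp add: compact_eq_bounded_closed Int_def)
qed

lemma limitin_curve_top_None:
  assumes "eventually (\<lambda>t. \<phi> t \<in> affine_curve f) F"
  shows   "limitin (curve_top f) (\<lambda>t. Some (\<phi> t)) None F \<longleftrightarrow> filterlim (\<lambda>t. fst (\<phi> t)) at_infinity F"
proof
  assume L: "limitin (curve_top f) (\<lambda>t. Some (\<phi> t)) None F"
  show "filterlim (\<lambda>t. fst (\<phi> t)) at_infinity F"
    unfolding filterlim_at_infinity[OF order.refl]
  proof (intro allI impI)
    fix R :: real assume "0 < R"
    let ?C = "{z \<in> affine_curve f. norm (fst z) \<le> R}"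
    have "compactin (top_of_set (affine_curve f)) ?C"
      using compact_affine_curve_part by (auto simp: compactin_subtopology)
    moreover have "closedin (top_of_set (affine_curve f)) ?C"
      using compact_imp_closed[OF compact_affine_curve_part] by (auto intro: closed_subset)
    ultimately have "openin (curve_top f) (insert None (Some ` (affine_curve f - ?C)))"
      unfolding curve_top_def openin_Alexandroff_compactification by auto
    from limitinD[OF L this] have "eventually (\<lambda>t. \<phi> t \<in> affine_curve f - ?C) F"
      by (auto elim!: eventually_mono)
    then show "eventually (\<lambda>t. R \<le> norm (fst (\<phi> t))) F"
      by eventually_elim auto
  qed
next
  assume L: "filterlim (\<lambda>t. fst (\<phi> t)) at_infinity F"
  show "limitin (curve_top f) (\<lambda>t. Some (\<phi> t)) None F"
    unfolding limitin_def
  proof (intro conjI allI impI)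
    show "None \<in> topspace (curve_top f)"
      by (simp add: curve_top_def)
    fix W assume W: "openin (curve_top f) W \<and> None \<in> W"
    then obtain C where C: "compactin (top_of_set (affine_curve f)) C"
        "W = insert None (Some ` (affine_curve f - C))"
      unfolding curve_top_def openin_Alexandroff_compactification by auto
    then have "bounded C"
      using compact_imp_bounded by (auto simp: compactin_subtopology)
    then obtain B where B: "B > 0" "\<And>z. z \<in> C \<Longrightarrow> norm z \<le> B"
      unfolding bounded_pos by blast
    have "eventually (\<lambda>t. B + 1 \<le> norm (fst (\<phi> t))) F"
      using L B(1) unfolding filterlim_at_infinity[OF order.refl] by simp
    with assms show "eventually (\<lambda>t. Some (\<phi> t) \<in> W) F"
    proof eventually_elim
      case (elim t)
      have "\<phi> t \<notin> C"
        using B(2)[of "\<phi> t"] elim(2) norm_fst_le[of "fst (\<phi> t)" "snd (\<phi> t)"] by auto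
      then show ?case using elim(1) C(2) by simp
    qed
  qed
qed

section \<open>Local coordinates\<close>

text \<open>
  The conditions of \<^const>\<open>local_param\<close> on the punctured disc, for the two coordinate functions.
\<close>

definition punctured_param :: "complex poly \<Rightarrow> (complex \<Rightarrow> complex) \<Rightarrow> (complex \<Rightarrow> complex) \<Rightarrow> real \<Rightarrow> bool" where
  "punctured_param f u v r \<longleftrightarrow> r > 0 \<and> u holomorphic_on ball 0 r - {0} \<and> v holomorphic_on ball 0 r - {0} \<and>
     inj_on (\<lambda>t. (u t, v t)) (ball 0 r - {0}) \<and> (\<forall>t\<in>ball 0 r - {0}. v t ^ 2 = poly f (u t))"

lemma punctured_param_smaller:
  "punctured_param f u v r \<Longrightarrow> 0 < s \<Longrightarrow> s \<le> r \<Longrightarrow> punctured_param f u v s"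
  unfolding punctured_param_def
  by (auto elim!: holomorphic_on_subset inj_on_subset)

lemma punctured_param_eventually:
  "punctured_param f u v r \<Longrightarrow> eventually (\<lambda>t. v t ^ 2 = poly f (u t)) (at 0)"
  unfolding punctured_param_def eventually_at by (intro exI[of _ r]) auto

lemma local_param_altdef:
  "local_param f P \<phi> \<longleftrightarrow> (\<exists>r. punctured_param f (\<lambda>t. fst (\<phi> t)) (\<lambda>t. snd (\<phi> t)) r) \<and>
     limitin (curve_top f) (\<lambda>t. Some (\<phi> t)) P (at 0)"
proof -
  have "\<phi> ` A \<subseteq> affine_curve f \<longleftrightarrow> (\<forall>t\<in>A. snd (\<phi> t) ^ 2 = poly f (fst (\<phi> t)))" for A
    by (auto simp: affine_curve_def image_subset_iff case_prod_beta)
  then show ?thesis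
    unfolding local_param_def punctured_param_def by auto
qed

lemma punctured_param_in_curve:
  "punctured_param f (\<lambda>t. fst (\<phi> t)) (\<lambda>t. snd (\<phi> t)) r \<Longrightarrow> eventually (\<lambda>t. \<phi> t \<in> affine_curve f) (at 0)"
  by (drule punctured_param_eventually, erule eventually_mono) (simp add: affine_curve_def case_prod_beta)

lemma local_param_Some_iff:
  "local_param f (Some (a, b)) \<phi> \<longleftrightarrow> b ^ 2 = poly f a \<and>
     (\<exists>r. punctured_param f (\<lambda>t. fst (\<phi> t)) (\<lambda>t. snd (\<phi> t)) r) \<and>
     ((\<lambda>t. fst (\<phi> t)) \<longlongrightarrow> a) (at 0) \<and> ((\<lambda>t. snd (\<phi> t)) \<longlongrightarrow> b) (at 0)"
proof -
  have tends: "(\<phi> \<longlongrightarrow> (a, b)) (at 0) \<longleftrightarrow>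
          ((\<lambda>t. fst (\<phi> t)) \<longlongrightarrow> a) (at 0) \<and> ((\<lambda>t. snd (\<phi> t)) \<longlongrightarrow> b) (at 0)"
  proof
    assume "(\<phi> \<longlongrightarrow> (a, b)) (at 0)"
    then show "((\<lambda>t. fst (\<phi> t)) \<longlongrightarrow> a) (at 0) \<and> ((\<lambda>t. snd (\<phi> t)) \<longlongrightarrow> b) (at 0)"
      using tendsto_fst[of \<phi> "(a, b)"] tendsto_snd[of \<phi> "(a, b)"] by simp
  next
    assume "((\<lambda>t. fst (\<phi> t)) \<longlongrightarrow> a) (at 0) \<and> ((\<lambda>t. snd (\<phi> t)) \<longlongrightarrow> b) (at 0)"
    then show "(\<phi> \<longlongrightarrow> (a, b)) (at 0)"
      using tendsto_Pair[of "\<lambda>t. fst (\<phi> t)" a "at 0" "\<lambda>t. snd (\<phi> t)" b] by simp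
  qed
  have mem: "(a, b) \<in> affine_curve f \<longleftrightarrow> b ^ 2 = poly f a"
    by (simp add: affine_curve_def)
  show ?thesis
  proof (cases "\<exists>r. punctured_param f (\<lambda>t. fst (\<phi> t)) (\<lambda>t. snd (\<phi> t)) r")
    case True
    then have "limitin (curve_top f) (\<lambda>t. Some (\<phi> t)) (Some (a, b)) (at 0) \<longleftrightarrow>
                 (a, b) \<in> affine_curve f \<and> (\<phi> \<longlongrightarrow> (a, b)) (at 0)"
      using limitin_curve_top_Some punctured_param_in_curve by blast
    with True show ?thesis
      unfolding local_param_altdef mem tends by simp
  next
    case False
    then show ?thesis unfolding local_param_altdef by simp
  qed
qed

lemma local_param_None_iff:
  "local_param f None \<phi> \<longleftrightarrow>
     (\<exists>r. punctured_param f (\<lambda>t. fst (\<phi> t)) (\<lambda>t. snd (\<phi> t)) r) \<and>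
     filterlim (\<lambda>t. fst (\<phi> t)) at_infinity (at 0)"
proof (cases "\<exists>r. punctured_param f (\<lambda>t. fst (\<phi> t)) (\<lambda>t. snd (\<phi> t)) r")
  case True
  then have "eventually (\<lambda>t. \<phi> t \<in> affine_curve f) (at 0)"
    using punctured_param_in_curve by blast
  from limitin_curve_top_None[OF this] True show ?thesis
    unfolding local_param_altdef by simp
next
  case False
  then show ?thesis unfolding local_param_altdef by simp
qed

text \<open>
  The inverse function theorem, in the form needed to construct local parameters with a prescribed
  coordinate function.
\<close>

lemma local_right_inverse:
  assumes "h holomorphic_on S" "open S" "z \<in> S" "h z = 0" "deriv h z \<noteq> (0::complex)"
  obtains G r where "r > 0" "G holomorphic_on ball 0 r" "G 0 = z" "G ` ball 0 r \<subseteq> S"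
    "\<forall>s\<in>ball 0 r. h (G s) = s"
proof -
  obtain e where e: "e > 0" "ball z e \<subseteq> S" "open (h ` ball z e)" "inj_on h (ball z e)"
    using has_complex_derivative_locally_invertible[OF assms(1,3,2,5)] .
  have hol: "h holomorphic_on ball z e"
    using assms(1) e(2) by (rule holomorphic_on_subset)
  obtain G where G: "G holomorphic_on (h ` ball z e)" "\<And>w. w \<in> ball z e \<Longrightarrow> G (h w) = w"
    using holomorphic_has_inverse[OF hol open_ball e(4)] by metis
  have "0 \<in> h ` ball z e"
    using imageI[of z "ball z e" h] assms(4) e(1) by simp
  with e(3) obtain r where r: "r > 0" "ball 0 r \<subseteq> h ` ball z e"
    by (rule openE)
  have Gs: "G s \<in> ball z e \<and> h (G s) = s" if s: "s \<in> ball 0 r" for s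
  proof -
    from r(2) s have "s \<in> h ` ball z e" by (rule subsetD)
    then obtain w where w: "s = h w" "w \<in> ball z e" by (rule imageE)
    show ?thesis
      unfolding w(1) G(2)[OF w(2)] using w(2) by simp
  qed
  show thesis
  proof (rule that[OF r(1)])
    show "G holomorphic_on ball 0 r"
      using G(1) r(2) by (rule holomorphic_on_subset)
    show "G 0 = z"
      using G(2)[of z] e(1) assms(4) by simp
    show "G ` ball 0 r \<subseteq> S"
    proof (rule image_subsetI)
      fix s assume "s \<in> ball (0::complex) r"
      from Gs[OF this] show "G s \<in> S" using subsetD[OF e(2)] by simp
    qed
    show "\<forall>s\<in>ball 0 r. h (G s) = s"
      using Gs by simp
  qed
qed

locale hyperelliptic =
  fixes f :: "complex poly" and g :: nat
  assumes degree_f: "degree f = 2 * g + 1"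
    and separable: "poly f a = 0 \<Longrightarrow> poly (pderiv f) a \<noteq> 0"
begin

lemma f_nonzero: "f \<noteq> 0"
  using degree_f by auto

lemma order_branch_root: "poly f a = 0 \<Longrightarrow> order a f = 1"
  using order_pderiv[OF f_nonzero] separable by (simp add: order_0I)

text \<open>
  With \<open>z = 1 / x\<close> this is \<open>x^(2g) / f(x)\<close>, the square of the function \<open>x^g / y\<close> on the curve. It is
  biholomorphic near \<open>z = 0\<close>, which makes \<open>x^g / y\<close> a coordinate at infinity.
\<close>

definition inf_coord :: "complex \<Rightarrow> complex" where
  "inf_coord z = z / poly (reflect_poly f) z"

lemma inf_coord_curve:
  assumes "u \<noteq> 0" "v ^ 2 = poly f u" "v \<noteq> 0"
  shows   "inf_coord (inverse u) = (u ^ g / v) ^ 2"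
proof -
  have "poly (reflect_poly f) (inverse u) = inverse u ^ (2 * g + 1) * v ^ 2"
    using poly_reflect_poly_nz[of "inverse u" f] assms by (simp add: degree_f)
  then have "inf_coord (inverse u) = inverse u / (inverse u ^ (2 * g + 1) * v ^ 2)"
    by (simp only: inf_coord_def)
  also have "\<dots> = u ^ (2 * g) / v ^ 2"
    using assms by (simp add: field_simps)
  also have "\<dots> = (u ^ g / v) ^ 2"
    by (simp add: power_divide power_even_eq)
  finally show ?thesis .
qed

lemma inf_coord_holomorphic:
  obtains e where "e > 0" "inf_coord holomorphic_on ball 0 e" "deriv inf_coord 0 \<noteq> 0"
    "\<forall>z\<in>ball 0 e. poly (reflect_poly f) z \<noteq> 0"
proof -
  have r0: "poly (reflect_poly f) 0 \<noteq> 0"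
    using f_nonzero by (simp add: poly_0_coeff_0)
  have "open {z. poly (reflect_poly f) z \<noteq> 0}"
    by (intro open_Collect_neq continuous_intros)
  moreover have "0 \<in> {z. poly (reflect_poly f) z \<noteq> 0}"
    using r0 by simp
  ultimately obtain e where e: "e > 0" "ball 0 e \<subseteq> {z. poly (reflect_poly f) z \<noteq> 0}"
    by (rule openE)
  have "(inf_coord has_field_derivative (1 / poly (reflect_poly f) 0)) (at 0)"
    unfolding inf_coord_def by (rule derivative_eq_intros refl | use r0 in simp)+
  then have "deriv inf_coord 0 \<noteq> 0"
    using DERIV_imp_deriv r0 by fastforce
  moreover have "inf_coord holomorphic_on ball 0 e"
    unfolding inf_coord_def by (intro holomorphic_intros) (use e(2) in auto)
  ultimately show thesis
    using that e by blast
qed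

end

lemma eventually_ball:
  assumes "eventually P (at (0::complex))"
  obtains r where "r > 0" "\<And>t. t \<in> ball 0 r - {0} \<Longrightarrow> P t"
  using assms unfolding eventually_at by (auto simp: dist_commute)

lemma poly_holomorphic: "poly p holomorphic_on A" for p :: "complex poly"
proof -
  have "(\<lambda>x. poly p x) holomorphic_on A" by (intro holomorphic_intros)
  then show ?thesis by simp
qed

lemma square_in_ball: "t \<in> ball 0 (min 1 r) \<Longrightarrow> t ^ 2 \<in> ball 0 r" for t :: complex
proof -
  assume t: "t \<in> ball 0 (min 1 r)"
  then have "norm t ^ 2 \<le> norm t"
    by (simp add: power2_eq_square mult_left_le)
  with t show ?thesis by (simp add: norm_power)
qed

context hyperelliptic
begin

lemma local_param_expansion:
  assumes "local_param f (Some (a, b)) \<phi>"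
  defines "u \<equiv> \<lambda>t. fst (\<phi> t)" and "v \<equiv> \<lambda>t. snd (\<phi> t)"
  obtains r where "punctured_param f u v r" "(u \<longlongrightarrow> a) (at 0)" "(v \<longlongrightarrow> b) (at 0)"
    "ord_ge u 0" "ord_ge v 0" "ord_ge (\<lambda>t. u t - a) 1" "ord_ge (\<lambda>t. v t - b) 1"
proof -
  obtain r where r: "punctured_param f u v r" and u: "(u \<longlongrightarrow> a) (at 0)" and v: "(v \<longlongrightarrow> b) (at 0)"
    using assms unfolding local_param_Some_iff u_def v_def by blast
  have ou: "ord_ge u 0" and ov: "ord_ge v 0"
    using r holomorphic_tendsto_ord_ge[OF _ _ u] holomorphic_tendsto_ord_ge[OF _ _ v]
    unfolding punctured_param_def by blast+
  have "((\<lambda>t. u t - a) \<longlongrightarrow> 0) (at 0)" "((\<lambda>t. v t - b) \<longlongrightarrow> 0) (at 0)"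
    using u v by (simp_all add: LIM_zero)
  moreover have "ord_ge (\<lambda>t. u t - a) 0" "ord_ge (\<lambda>t. v t - b) 0"
    using ou ov by (auto intro: ord_ge_diff ord_ge_const)
  ultimately have "ord_ge (\<lambda>t. u t - a) 1" "ord_ge (\<lambda>t. v t - b) 1"
    using ord_ge_1_iff_tendsto_0 by blast+
  with r u v ou ov show thesis by (rule that)
qed

text \<open>
  Near \<open>(a, b)\<close> the coordinate \<open>x\<close> determines \<open>y\<close>, because \<open>y\<^sup>2 = f(x)\<close> leaves only the choice of a
  sign and \<open>y\<close> is close to \<open>b \<noteq> 0\<close>. So \<open>x - a\<close> is injective along a parameter.
\<close>

lemma ordinary_point_coordinate:
  assumes "local_param f (Some (a, b)) \<phi>" "b \<noteq> 0"
  shows   "has_ord (\<lambda>t. fst (\<phi> t) - a) 1"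
proof -
  define u where "u = (\<lambda>t. fst (\<phi> t))"
  define v where "v = (\<lambda>t. snd (\<phi> t))"
  obtain r where r: "punctured_param f u v r" and u: "(u \<longlongrightarrow> a) (at 0)" and v: "(v \<longlongrightarrow> b) (at 0)"
      and ou: "ord_ge (\<lambda>t. u t - a) 1"
    using local_param_expansion[OF assms(1)] unfolding u_def v_def by blast
  have "eventually (\<lambda>t. dist (v t) b < norm b) (at 0)"
    using tendstoD[OF v] assms(2) by simp
  then obtain s where s: "s > 0" "\<And>t. t \<in> ball 0 s - {0} \<Longrightarrow> dist (v t) b < norm b"
    by (rule eventually_ball) blast
  define e where "e = min r s"
  have e: "punctured_param f u v e"
    using punctured_param_smaller[OF r] r s(1) by (simp add: e_def punctured_param_def)
  have "inj_on (\<lambda>t. u t - a) (ball 0 e - {0})"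
  proof (rule inj_onI)
    fix x y assume xy: "x \<in> ball 0 e - {0}" "y \<in> ball 0 e - {0}" "u x - a = u y - a"
    then have "v x ^ 2 = v y ^ 2"
      using e unfolding punctured_param_def by auto
    then have "v x = v y \<or> v x = - v y"
      by (simp add: power2_eq_iff)
    moreover have "v x \<noteq> - v y"
    proof
      assume neg: "v x = - v y"
      have "norm (2 * b) = norm ((b - v x) + (b - v y))"
        using neg by (simp add: algebra_simps)
      also have "\<dots> \<le> dist (v x) b + dist (v y) b"
        by (metis dist_commute dist_norm norm_triangle_ineq)
      also have "\<dots> < norm b + norm b"
        using s(2)[of x] s(2)[of y] xy(1,2) by (intro add_strict_mono) (auto simp: e_def)
      finally show False by (simp add: norm_mult)
    qed
    ultimately have "(u x, v x) = (u y, v y)"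
      using xy(3) by simp
    then show "x = y"
      using e xy(1,2) unfolding punctured_param_def by (blast dest: inj_onD)
  qed
  moreover have "(\<lambda>t. u t - a) holomorphic_on ball 0 e - {0}"
    using e unfolding punctured_param_def by (auto intro: holomorphic_intros)
  moreover have "e > 0"
    using e by (simp add: punctured_param_def)
  ultimately show ?thesis
    using injective_has_ord_1[OF ou] unfolding u_def by blast
qed

text \<open>
  At a branch point \<open>y\<close> determines \<open>f(x) = y\<^sup>2\<close>, hence \<open>x\<close>, as \<open>f\<close> is injective near a simple root.
  So \<open>y\<close> has order \<open>1\<close>, and \<open>x - a\<close> has the order of \<open>f(x) = y\<^sup>2\<close>.
\<close>

lemma branch_point_coordinate:
  assumes "local_param f (Some (a, 0)) \<phi>"
  shows   "has_ord (\<lambda>t. snd (\<phi> t)) 1" "has_ord (\<lambda>t. fst (\<phi> t) - a) 2"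
proof -
  define u where "u = (\<lambda>t. fst (\<phi> t))"
  define v where "v = (\<lambda>t. snd (\<phi> t))"
  obtain r where r: "punctured_param f u v r" and u: "(u \<longlongrightarrow> a) (at 0)"
      and ou: "ord_ge (\<lambda>t. u t - a) 1" and ov: "ord_ge v 1"
    using local_param_expansion[OF assms(1)] unfolding u_def v_def by auto
  have root: "poly f a = 0"
    using assms by (simp add: local_param_Some_iff)
  have "deriv (poly f) a \<noteq> 0"
    using separable[OF root] DERIV_imp_deriv[OF poly_DERIV] by metis
  then obtain s where s: "s > 0" "inj_on (poly f) (ball a s)"
    using has_complex_derivative_locally_injective[OF poly_holomorphic UNIV_I open_UNIV] by metis
  have "eventually (\<lambda>t. dist (u t) a < s) (at 0)"
    using tendstoD[OF u s(1)] .
  then obtain s' where s': "s' > 0" "\<And>t. t \<in> ball 0 s' - {0} \<Longrightarrow> dist (u t) a < s"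
    by (rule eventually_ball) blast
  define e where "e = min r s'"
  have e: "punctured_param f u v e"
    using punctured_param_smaller[OF r] r s'(1) by (simp add: e_def punctured_param_def)
  have "inj_on v (ball 0 e - {0})"
  proof (rule inj_onI)
    fix x y assume xy: "x \<in> ball 0 e - {0}" "y \<in> ball 0 e - {0}" "v x = v y"
    then have "poly f (u x) = poly f (u y)"
      using e unfolding punctured_param_def by metis
    moreover have "u x \<in> ball a s" "u y \<in> ball a s"
      using s'(2)[of x] s'(2)[of y] xy(1,2) by (auto simp: e_def dist_commute)
    ultimately have "u x = u y"
      using inj_onD[OF s(2)] by blast
    then have "(u x, v x) = (u y, v y)"
      using xy(3) by simp
    then show "x = y"
      using e xy(1,2) unfolding punctured_param_def by (blast dest: inj_onD)
  qed
  moreover have "v holomorphic_on ball 0 e - {0}" "e > 0"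
    using e unfolding punctured_param_def by auto
  ultimately have v1: "has_ord v 1"
    using injective_has_ord_1[OF ov] by blast
  then show "has_ord (\<lambda>t. snd (\<phi> t)) 1"
    by (simp add: v_def)
  have curve: "eventually (\<lambda>t. v t ^ 2 = poly f (u t)) (at 0)"
    using punctured_param_eventually[OF r] .
  have f2: "has_ord (\<lambda>t. poly f (u t)) 2"
    using has_ord_cong[OF has_ord_power[OF v1, of 2] curve] by simp
  from ou have "has_ord (\<lambda>t. u t - a) 2"
  proof (cases rule: ord_ge_cases)
    case zero
    have "eventually (\<lambda>t::complex. False) (at 0)"
      using zero has_ord_eventually_nonzero[OF f2] by eventually_elim (simp add: root)
    then show ?thesis by simp
  next
    case (ord n)
    then have "has_ord (\<lambda>t. poly f (u t)) (int (order a f) * n)"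
      by (intro has_ord_poly_at f_nonzero) auto
    then have "int (order a f) * n = 2"
      using f2 has_ord_unique by blast
    then have "n = 2"
      by (simp add: order_branch_root[OF root])
    then show ?thesis using ord by simp
  qed
  then show "has_ord (\<lambda>t. fst (\<phi> t) - a) 2"
    by (simp add: u_def)
qed

text \<open>
  If \<open>x\<close> has a pole of order \<open>n\<close> and \<open>y\<close> one of order \<open>m\<close>, then \<open>2 m = (2 g + 1) n\<close> from
  \<open>y\<^sup>2 = f(x)\<close>, so \<open>w = x^g / y\<close> has order \<open>m - g n = n / 2\<close>. Near infinity \<open>w\<^sup>2\<close> determines \<open>1 / x\<close>, and
  then \<open>w\<close> determines \<open>y\<close>; so \<open>w\<close> is injective, and \<open>n = 2\<close>.
\<close>

lemma infinity_coordinate: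
  assumes "local_param f None \<phi>"
  shows   "has_ord (\<lambda>t. fst (\<phi> t)) (- 2)" "has_ord (\<lambda>t. snd (\<phi> t)) (- int (2 * g + 1))"
proof -
  define u where "u = (\<lambda>t. fst (\<phi> t))"
  define v where "v = (\<lambda>t. snd (\<phi> t))"
  obtain r where r: "punctured_param f u v r" and u: "filterlim u at_infinity (at 0)"
    using assms unfolding local_param_None_iff u_def v_def by blast
  have r': "r > 0" "u holomorphic_on ball 0 r - {0}" "v holomorphic_on ball 0 r - {0}"
    using r unfolding punctured_param_def by auto
  obtain n where n: "n > 0" "has_ord u (- n)"
    using holomorphic_filterlim_ord_ge[OF r'(2,1) u] .
  have curve: "eventually (\<lambda>t. v t ^ 2 = poly f (u t)) (at 0)"
    using punctured_param_eventually[OF r] .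
  have fn: "has_ord (\<lambda>t. poly f (u t)) (- (int (2 * g + 1) * n))"
    using has_ord_poly_pole[OF n(2,1) f_nonzero] by (simp add: degree_f)
  have flim: "filterlim (\<lambda>t. poly f (u t)) at_infinity (at 0)"
  proof -
    obtain L where "(\<lambda>t. poly f (u t)) has_laurent_expansion L" "fls_subdegree L = - (int (2 * g + 1) * n)"
      using fn unfolding has_ord_def by blast
    moreover have "- (int (2 * g + 1) * n) < 0"
      using n(1) by simp
    ultimately show ?thesis
      using has_laurent_expansion_imp_filterlim_infinity_0 by metis
  qed
  have "filterlim v at_infinity (at 0)"
    unfolding filterlim_at_infinity[OF order.refl]
  proof (intro allI impI)
    fix R :: real assume "R > 0"
    then have "eventually (\<lambda>t. R ^ 2 \<le> norm (poly f (u t))) (at 0)"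
      using flim unfolding filterlim_at_infinity[OF order.refl] by simp
    with curve show "eventually (\<lambda>t. R \<le> norm (v t)) (at 0)"
    proof eventually_elim
      case (elim t)
      then have "R ^ 2 \<le> norm (v t) ^ 2"
        by (simp flip: norm_power)
      then show ?case by (rule power2_le_imp_le) simp
    qed
  qed
  from holomorphic_filterlim_ord_ge[OF r'(3,1) this]
  obtain m where m: "m > 0" "has_ord v (- m)" .
  have "has_ord (\<lambda>t. v t ^ 2) (- (int (2 * g + 1) * n))"
    using fn by (rule has_ord_cong) (use curve in \<open>auto elim: eventually_mono\<close>)
  then have mn: "2 * m = int (2 * g + 1) * n"
    using has_ord_unique[OF has_ord_power[OF m(2), of 2]] by fastforce
  define w where "w = (\<lambda>t. u t ^ g / v t)"
  have w: "has_ord w (int g * - n - - m)"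
    unfolding w_def by (intro has_ord_divide has_ord_power n m)
  have wn: "2 * (int g * - n - - m) = n"
    using mn by (simp add: algebra_simps)
  obtain d where d: "d > 0" "inf_coord holomorphic_on ball 0 d" "deriv inf_coord 0 \<noteq> 0"
    using inf_coord_holomorphic by metis
  obtain s where s: "s > 0" "inj_on inf_coord (ball 0 s)"
    using has_complex_derivative_locally_injective[OF d(2) _ open_ball d(3)] d(1) by auto
  have "eventually (\<lambda>t. 1 / s + 1 \<le> norm (u t)) (at 0)"
    using u s(1) unfolding filterlim_at_infinity[OF order.refl] by (simp add: add_pos_pos)
  then have "eventually (\<lambda>t. 1 / s + 1 \<le> norm (u t) \<and> v t \<noteq> 0) (at 0)"
    using has_ord_eventually_nonzero[OF m(2)] by eventually_elim simp
  then obtain s' where s': "s' > 0" "\<And>t. t \<in> ball 0 s' - {0} \<Longrightarrow> 1 / s + 1 \<le> norm (u t) \<and> v t \<noteq> 0"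
    by (rule eventually_ball) blast
  define e where "e = min r s'"
  have e: "punctured_param f u v e"
    using punctured_param_smaller[OF r] r' s'(1) by (simp add: e_def)
  have large: "u t \<noteq> 0" "v t \<noteq> 0" "inverse (u t) \<in> ball 0 s" if "t \<in> ball 0 e - {0}" for t
  proof -
    have t: "1 / s + 1 \<le> norm (u t)" "v t \<noteq> 0"
      using s'(2)[of t] that by (auto simp: e_def)
    have pos: "0 < 1 / s"
      using s(1) by simp
    then have "0 < norm (u t)"
      using t(1) by linarith
    then show "u t \<noteq> 0" "v t \<noteq> 0"
      using t(2) by auto
    have "inverse (norm (u t)) < inverse (1 / s)"
      using t(1) pos by (intro less_imp_inverse_less) auto
    then show "inverse (u t) \<in> ball 0 s"
      by (simp add: norm_inverse)
  qed
  have "inj_on w (ball 0 e - {0})"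
  proof (rule inj_onI)
    fix x y assume xy: "x \<in> ball 0 e - {0}" "y \<in> ball 0 e - {0}" "w x = w y"
    have curve_at: "inf_coord (inverse (u t)) = w t ^ 2" if "t \<in> ball 0 e - {0}" for t
      unfolding w_def using inf_coord_curve large[OF that] e that
      unfolding punctured_param_def by blast
    have "inf_coord (inverse (u x)) = inf_coord (inverse (u y))"
      using curve_at[OF xy(1)] curve_at[OF xy(2)] xy(3) by simp
    then have "inverse (u x) = inverse (u y)"
      using inj_onD[OF s(2)] large[OF xy(1)] large[OF xy(2)] by blast
    then have "u x = u y" by simp
    moreover from this have "v x = v y"
      using xy(3) large(1,2)[OF xy(1)] large(1,2)[OF xy(2)] by (simp add: w_def)
    ultimately show "x = y"
      using e xy(1,2) unfolding punctured_param_def by (auto dest: inj_onD)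
  qed
  moreover have "w holomorphic_on ball 0 e - {0}"
    unfolding w_def using e large(2) unfolding punctured_param_def by (intro holomorphic_intros) auto
  moreover have "e > 0"
    using e by (simp add: punctured_param_def)
  moreover have "ord_ge w 1"
    by (rule has_ord_imp_ord_ge'[OF w]) (use wn n(1) in presburger)
  ultimately have "has_ord w 1"
    using injective_has_ord_1 by blast
  then have "int g * - n - - m = 1"
    using w has_ord_unique by blast
  then have "n = 2" using wn by simp
  moreover from this have "m = int (2 * g + 1)" using mn by simp
  ultimately show "has_ord (\<lambda>t. fst (\<phi> t)) (- 2)" "has_ord (\<lambda>t. snd (\<phi> t)) (- int (2 * g + 1))"
    using n m by (simp_all add: u_def v_def)
qed

text \<open>
  Since \<^const>\<open>ord_at\<close> evaluates an arbitrarily chosen parameter, one has to exist at every point. The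
  coordinates found above are taken as the variable \<open>t\<close>: here \<open>t = x - a\<close>, at branch points \<open>t = y\<close>,
  and at infinity \<open>t = x^g / y\<close>.
\<close>

lemma local_param_exists_ordinary:
  assumes "b ^ 2 = poly f a" "b \<noteq> 0"
  shows   "\<exists>\<phi>. local_param f (Some (a, b)) \<phi>"
proof -
  define h where "h = (\<lambda>t. poly f (a + t) / b ^ 2)"
  have h0: "h 0 = 1"
    using assms by (simp add: h_def flip: assms(1))
  have hcont: "continuous_on UNIV h"
    unfolding h_def using assms(2) by (intro continuous_intros) auto
  have "open {t. 0 < Re (h t)}"
    by (intro open_Collect_less continuous_intros hcont)
  moreover have "0 \<in> {t. 0 < Re (h t)}"
    by (simp add: h0)
  ultimately obtain r where r: "r > 0" "ball 0 r \<subseteq> {t. 0 < Re (h t)}"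
    by (rule openE)
  define v where "v = (\<lambda>t. b * csqrt (h t))"
  have v: "v holomorphic_on ball 0 r"
    unfolding v_def
  proof (intro holomorphic_intros)
    show "h holomorphic_on ball 0 r"
      unfolding h_def using assms(2) by (intro holomorphic_intros) auto
    show "h z \<notin> \<real>\<^sub>\<le>\<^sub>0" if "z \<in> ball 0 r" for z
      using subsetD[OF r(2) that] by (auto simp: complex_nonpos_Reals_iff)
  qed
  have "isCont v 0"
    using v r(1) by (meson centre_in_ball continuous_on_eq_continuous_at holomorphic_on_imp_continuous_on open_ball)
  then have "(v \<longlongrightarrow> b) (at 0)"
    by (simp add: isCont_def v_def h0)
  moreover have "((\<lambda>t. a + t) \<longlongrightarrow> a) (at 0)"
    by (auto intro!: tendsto_eq_intros)
  moreover have "punctured_param f (\<lambda>t. a + t) v r"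
    unfolding punctured_param_def
  proof (intro conjI ballI)
    show "v holomorphic_on ball 0 r - {0}"
      using v by (rule holomorphic_on_subset) auto
    show "v t ^ 2 = poly f (a + t)" for t
      using assms(2) by (simp add: v_def h_def power_mult_distrib)
  qed (use r in \<open>auto intro: holomorphic_intros inj_onI\<close>)
  ultimately show ?thesis
    unfolding local_param_Some_iff using assms(1) by (intro exI[of _ "\<lambda>t. (a + t, v t)"]) auto
qed

lemma local_param_exists_branch:
  assumes "poly f a = 0"
  shows   "\<exists>\<phi>. local_param f (Some (a, 0)) \<phi>"
proof -
  have "deriv (poly f) a \<noteq> 0"
    using separable[OF assms] DERIV_imp_deriv[OF poly_DERIV] by metis
  then obtain G r where G: "r > 0" "G holomorphic_on ball 0 r" "G 0 = a"
      "\<forall>s\<in>ball 0 r. poly f (G s) = s"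
    using local_right_inverse[OF poly_holomorphic open_UNIV UNIV_I assms] by metis
  define u where "u = (\<lambda>t::complex. G (t ^ 2))"
  define s where "s = min 1 r"
  have sq: "t ^ 2 \<in> ball 0 r" if "t \<in> ball 0 s" for t :: complex
    using square_in_ball that unfolding s_def .
  have u: "u holomorphic_on ball 0 s"
    unfolding u_def by (rule holomorphic_on_compose_gen[of "\<lambda>t. t ^ 2" _ G, unfolded o_def])
      (use G(2) sq in \<open>auto intro!: holomorphic_intros\<close>)
  have s0: "s > 0" using G(1) by (simp add: s_def)
  have "isCont u 0"
    using u s0 by (meson centre_in_ball continuous_on_eq_continuous_at holomorphic_on_imp_continuous_on open_ball)
  then have "(u \<longlongrightarrow> a) (at 0)"
    by (simp add: isCont_def u_def G(3))
  moreover have "punctured_param f u (\<lambda>t. t) s"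
    unfolding punctured_param_def
  proof (intro conjI ballI)
    show "u holomorphic_on ball 0 s - {0}"
      using u by (rule holomorphic_on_subset) auto
    show "t ^ 2 = poly f (u t)" if "t \<in> ball 0 s - {0}" for t
      using bspec[OF G(4) sq, of t] that by (simp add: u_def)
  qed (use s0 in \<open>auto intro: holomorphic_intros inj_onI\<close>)
  ultimately show ?thesis
    unfolding local_param_Some_iff using assms by (intro exI[of _ "\<lambda>t. (u t, t)"]) auto
qed

lemma local_param_exists_infinity: "\<exists>\<phi>. local_param f None \<phi>"
proof -
  obtain d where d: "d > 0" "inf_coord holomorphic_on ball 0 d" "deriv inf_coord 0 \<noteq> 0"
      "\<forall>z\<in>ball 0 d. poly (reflect_poly f) z \<noteq> 0"
    using inf_coord_holomorphic .
  obtain G r where G: "r > 0" "G holomorphic_on ball 0 r" "G 0 = 0" "G ` ball 0 r \<subseteq> ball 0 d"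
      "\<forall>s\<in>ball 0 r. inf_coord (G s) = s"
  proof (rule local_right_inverse[OF d(2) open_ball _ _ d(3)])
    show "0 \<in> ball 0 d" "inf_coord 0 = 0"
      using d(1) by (simp_all add: inf_coord_def)
  qed
  define s where "s = min 1 r"
  have s0: "s > 0" using G(1) by (simp add: s_def)
  have sq: "t ^ 2 \<in> ball 0 r" if "t \<in> ball 0 s" for t :: complex
    using square_in_ball that unfolding s_def .
  define z where "z = (\<lambda>t::complex. G (t ^ 2))"
  have z: "z holomorphic_on ball 0 s"
    unfolding z_def by (rule holomorphic_on_compose_gen[of "\<lambda>t. t ^ 2" _ G, unfolded o_def])
      (use G(2) sq in \<open>auto intro!: holomorphic_intros\<close>)
  have zt: "inf_coord (z t) = t ^ 2" "poly (reflect_poly f) (z t) \<noteq> 0" if "t \<in> ball 0 s" for t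
    using G(4,5) d(4) sq[OF that] unfolding z_def by (blast, blast)
  have znz: "z t \<noteq> 0" if "t \<in> ball 0 s - {0}" for t
    using zt(1)[of t] that by (auto simp: inf_coord_def)
  define u where "u = (\<lambda>t. inverse (z t))"
  define v where "v = (\<lambda>t. u t ^ g / t)"
  have curve: "v t ^ 2 = poly f (u t)" if t: "t \<in> ball 0 s - {0}" for t
  proof -
    have "poly (reflect_poly f) (z t) = z t ^ (2 * g + 1) * poly f (u t)"
      using poly_reflect_poly_nz[OF znz[OF t], of f] by (simp add: degree_f u_def)
    moreover have "poly (reflect_poly f) (z t) * t ^ 2 = z t"
      using zt[of t] t by (simp add: inf_coord_def field_simps)
    ultimately have "z t * (z t ^ (2 * g) * (poly f (u t) * t ^ 2)) = z t * 1"
      by (simp add: mult_ac)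
    then have "z t ^ (2 * g) * (poly f (u t) * t ^ 2) = 1"
      using znz[OF t] by simp
    then have "poly f (u t) = inverse (z t ^ (2 * g)) / t ^ 2"
      using znz[OF t] t by (simp add: field_simps)
    also have "\<dots> = v t ^ 2"
      by (simp add: v_def u_def power_divide power_inverse power_even_eq power_mult_distrib)
    finally show ?thesis ..
  qed
  have "punctured_param f u v s"
    unfolding punctured_param_def
  proof (intro conjI ballI)
    have z': "z holomorphic_on ball 0 s - {0}"
      using z by (rule holomorphic_on_subset) auto
    show "u holomorphic_on ball 0 s - {0}"
      unfolding u_def using z' znz by (intro holomorphic_intros) auto
    then show "v holomorphic_on ball 0 s - {0}"
      unfolding v_def by (intro holomorphic_intros) auto
    show "inj_on (\<lambda>t. (u t, v t)) (ball 0 s - {0})"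
    proof (rule inj_onI)
      fix x y assume xy: "x \<in> ball 0 s - {0}" "y \<in> ball 0 s - {0}" "(u x, v x) = (u y, v y)"
      then have "u y ^ g / x = u y ^ g / y" "u y \<noteq> 0"
        using znz[of y] by (auto simp: v_def u_def)
      then show "x = y"
        using xy(1,2) by (simp add: field_simps)
    qed
  qed (use s0 curve in auto)
  moreover have "filterlim u at_infinity (at 0)"
  proof -
    have "isCont z 0"
      using z s0 by (meson centre_in_ball continuous_on_eq_continuous_at holomorphic_on_imp_continuous_on open_ball)
    then have "(z \<longlongrightarrow> 0) (at 0)"
      by (simp add: isCont_def z_def G(3))
    moreover have "eventually (\<lambda>t. z t \<noteq> 0) (at 0)"
      using znz s0 unfolding eventually_at by (intro exI[of _ s]) auto
    ultimately have "filterlim z (at 0) (at 0)"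
      by (simp add: filterlim_at)
    then show ?thesis
      unfolding u_def by (rule filterlim_compose[OF filterlim_inverse_at_infinity])
  qed
  ultimately show ?thesis
    unfolding local_param_None_iff by (intro exI[of _ "\<lambda>t. (u t, v t)"]) auto
qed

lemma local_param_exists:
  assumes "P \<in> curve f"
  shows   "\<exists>\<phi>. local_param f P \<phi>"
proof (cases P)
  case None
  then show ?thesis using local_param_exists_infinity by simp
next
  case (Some z)
  obtain a b where z: "z = (a, b)" by (cases z)
  have "b ^ 2 = poly f a"
    using assms Some z by (auto simp: curve_def affine_curve_def)
  then show ?thesis
    using local_param_exists_ordinary[of b a] local_param_exists_branch[of a] Some z
    by (cases "b = 0") auto
qed

end

section \<open>Sections of the multiples of D\<close>

lemma eval_ratfun_poly:
  "eval_ratfun (to_fract P, to_fract Q) z = poly P (fst z) + poly Q (fst z) * snd z"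
  by (simp add: eval_ratfun_def eval_fract_def split: prod.splits)

lemma eval_fract_divide:
  assumes "poly d x \<noteq> 0"
  shows   "eval_fract (to_fract n / to_fract d) x = poly n x / poly d x"
proof -
  define A where "A = to_fract n / to_fract d"
  obtain n' d' where q: "quot_of_fract A = (n', d')"
    by (cases "quot_of_fract A")
  have d': "d' \<noteq> 0"
    using snd_quot_of_fract_nonzero[of A] by (simp add: q)
  have d: "d \<noteq> 0" using assms by auto
  have "Fract n' d' = A"
    using Fract_quot_of_fract[of A] by (simp add: q)
  also have "A = Fract n d"
    by (simp add: A_def Fract_conv_to_fract)
  finally have "Fract n' d' = Fract n d" .
  then have eq: "n' * d = n * d'"
    using d d' by (simp add: eq_fract)
  then have "d' dvd n' * d"
    by simp
  moreover have "coprime d' n'"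
    using coprime_quot_of_fract[of A] by (simp add: q coprime_commute)
  ultimately have "d' dvd d"
    by (simp add: coprime_dvd_mult_right_iff)
  then have "poly d' x \<noteq> 0"
    using assms by (auto elim!: dvdE)
  moreover have "poly n' x * poly d x = poly n x * poly d' x"
    using eq by (metis poly_mult)
  ultimately show ?thesis
    using assms by (simp add: eval_fract_def q frac_eq_eq flip: A_def)
qed

lemma common_denominator:
  fixes A B :: "complex poly fract"
  obtains n1 n2 d where "d \<noteq> 0" "A = to_fract n1 / to_fract d" "B = to_fract n2 / to_fract d"
proof -
  define a where "a = fst (quot_of_fract A)"
  define b where "b = snd (quot_of_fract A)"
  define c where "c = fst (quot_of_fract B)"
  define d where "d = snd (quot_of_fract B)"
  have nz: "b \<noteq> 0" "d \<noteq> 0"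
    by (simp_all add: b_def d_def)
  have "A = to_fract a / to_fract b" "B = to_fract c / to_fract d"
    unfolding a_def b_def c_def d_def Fract_conv_to_fract[symmetric] by simp_all
  then have "A = to_fract (a * d) / to_fract (b * d)" "B = to_fract (c * b) / to_fract (b * d)"
    using nz by simp_all
  moreover have "b * d \<noteq> 0"
    using nz by simp
  ultimately show thesis
    using that by metis
qed

text \<open>
  For \<open>d = k - g\<close> these are the functions that are regular on the affine curve and have a pole of order
  at most \<open>2 k\<close> at infinity: \<open>x\<close> has a double pole there and \<open>y\<close> a pole of order \<open>2 g + 1\<close>.
\<close>

definition bounded_functions :: "nat \<Rightarrow> nat \<Rightarrow> ratfun set" where
  "bounded_functions k d = {(to_fract P, to_fract Q) | P Q. degree P \<le> k \<and> degree Q < d}"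

lemma real_polynomial_real_ratfun:
  assumes "\<And>i. coeff P i \<in> \<real>" "\<And>i. coeff Q i \<in> \<real>"
  shows   "real_ratfun f (to_fract P, to_fract Q)"
proof -
  have "poly P (cnj x) = cnj (poly P x)" "poly Q (cnj x) = cnj (poly Q x)" for x
    using assms by (simp_all add: poly_cnj_real)
  then show ?thesis
    by (simp add: real_ratfun_def eval_ratfun_poly conj_affine_def case_prod_beta)
qed

text \<open>
  Splitting the coefficients of \<open>P\<close> and \<open>Q\<close> into real and imaginary parts exhibits every function of this
  kind as a complex combination of two real ones, so complexifying the real sections loses nothing.
\<close>

lemma complexification_bounded_functions:
  assumes "sections f E = bounded_functions k d"
  shows   "complexification (real_sections f E) = bounded_functions k d"
proof (intro equalityI subsetI)
  fix h assume "h \<in> complexification (real_sections f E)"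
  then obtain s s' where h: "h = s + const_mult \<i> s'" "s \<in> bounded_functions k d" "s' \<in> bounded_functions k d"
    unfolding complexification_def real_sections_def assms by blast
  obtain P Q where s: "s = (to_fract P, to_fract Q)" "degree P \<le> k" "degree Q < d"
    using h(2) unfolding bounded_functions_def by blast
  obtain P' Q' where s': "s' = (to_fract P', to_fract Q')" "degree P' \<le> k" "degree Q' < d"
    using h(3) unfolding bounded_functions_def by blast
  have "h = (to_fract (P + [:\<i>:] * P'), to_fract (Q + [:\<i>:] * Q'))"
    unfolding h(1) s(1) s'(1) const_mult_def to_fract_add to_fract_mult by simp
  moreover have "degree (P + [:\<i>:] * P') \<le> k" "degree (Q + [:\<i>:] * Q') < d"
    using s(2,3) s'(2,3) by (simp_all add: degree_add_le degree_add_less)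
  ultimately show "h \<in> bounded_functions k d"
    unfolding bounded_functions_def by blast
next
  fix h assume "h \<in> bounded_functions k d"
  then obtain P Q where h: "h = (to_fract P, to_fract Q)" "degree P \<le> k" "degree Q < d"
    unfolding bounded_functions_def by blast
  define re where "re = map_poly (\<lambda>z. complex_of_real (Re z))"
  define im where "im = map_poly (\<lambda>z. complex_of_real (Im z))"
  have split: "p = re p + [:\<i>:] * im p" for p
    by (rule poly_eqI) (simp add: re_def im_def coeff_map_poly complex_eq[symmetric])
  have deg: "degree (re p) \<le> degree p" "degree (im p) \<le> degree p" for p
    unfolding re_def im_def by (rule degree_le, simp add: coeff_map_poly coeff_eq_0)+
  have real: "coeff (re p) i \<in> \<real>" "coeff (im p) i \<in> \<real>" for p i
    by (simp_all add: re_def im_def coeff_map_poly)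
  have "degree (re P) \<le> k" "degree (im P) \<le> k" "degree (re Q) < d" "degree (im Q) < d"
    using h(2,3) deg[of P] deg[of Q] by linarith+
  then have "(to_fract (re P), to_fract (re Q)) \<in> real_sections f E"
       "(to_fract (im P), to_fract (im Q)) \<in> real_sections f E"
    using real_polynomial_real_ratfun[OF real(1) real(1)]
      real_polynomial_real_ratfun[OF real(2) real(2)]
    unfolding real_sections_def assms bounded_functions_def by blast+
  moreover have "h = (to_fract (re P), to_fract (re Q)) + const_mult \<i> (to_fract (im P), to_fract (im Q))"
  proof -
    have "to_fract p = to_fract (re p) + to_fract [:\<i>:] * to_fract (im p)" for p
      unfolding to_fract_mult[symmetric] to_fract_add[symmetric] by (rule arg_cong[OF split])
    then show ?thesis
      unfolding h(1) const_mult_def case_prod_conv add_Pair by (intro arg_cong2[of _ _ _ _ Pair])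
  qed
  ultimately show "h \<in> complexification (real_sections f E)"
    unfolding complexification_def by blast
qed

text \<open>
  Where the orders of \<open>P(x)\<close> and \<open>Q(x) y\<close> have different parity the two terms cannot cancel, so the
  order of their sum is the smaller one. This is what makes the points fixed by \<open>(x, y) \<mapsto> (x, - y)\<close>
  explicitly computable.
\<close>

lemma has_ord_add_parity:
  assumes "P \<noteq> 0 \<Longrightarrow> has_ord (\<lambda>t. poly P (u t)) m" "Q \<noteq> 0 \<Longrightarrow> has_ord (\<lambda>t. poly Q (u t) * v t) n"
    and "m \<noteq> n" "P \<noteq> 0 \<or> Q \<noteq> 0"
  shows "has_ord (\<lambda>t. poly P (u t) + poly Q (u t) * v t) (if Q = 0 then m else if P = 0 then n else min m n)"
  using assms has_ord_add'[of "\<lambda>t. poly P (u t)" m "\<lambda>t. poly Q (u t) * v t" n]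
  by (cases "P = 0"; cases "Q = 0") simp_all

context hyperelliptic
begin

lemma ord_at_eqI:
  assumes "P \<in> curve f" "\<And>\<phi>. local_param f P \<phi> \<Longrightarrow> has_ord (\<lambda>t. eval_ratfun h (\<phi> t)) m"
  shows   "ord_at f P h = m"
  unfolding ord_at_def using assms(2)[OF someI_ex[OF local_param_exists[OF assms(1)]]] has_ord_zorder by blast

lemma ord_at_branch_point:
  assumes "poly f a = 0" "P \<noteq> 0 \<or> Q \<noteq> 0"
  shows   "ord_at f (Some (a, 0)) (to_fract P, to_fract Q) =
             (if Q = 0 then 2 * int (order a P) else if P = 0 then 2 * int (order a Q) + 1
              else min (2 * int (order a P)) (2 * int (order a Q) + 1))"
proof (rule ord_at_eqI)
  show "Some (a, 0) \<in> curve f"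
    using assms(1) by (simp add: curve_def affine_curve_def)
  fix \<phi> assume \<phi>: "local_param f (Some (a, 0)) \<phi>"
  note coords = branch_point_coordinate[OF \<phi>]
  have 1: "has_ord (\<lambda>t. poly P (fst (\<phi> t))) (2 * int (order a P))" if "P \<noteq> 0"
    using has_ord_poly_at[OF coords(2) _ that] by (simp add: mult.commute)
  have 2: "has_ord (\<lambda>t. poly Q (fst (\<phi> t)) * snd (\<phi> t)) (2 * int (order a Q) + 1)" if "Q \<noteq> 0"
    using has_ord_mult[OF has_ord_poly_at[OF coords(2) _ that] coords(1)] by (simp add: mult.commute)
  have 3: "2 * int (order a P) \<noteq> 2 * int (order a Q) + 1"
    by presburger
  show "has_ord (\<lambda>t. eval_ratfun (to_fract P, to_fract Q) (\<phi> t))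
     (if Q = 0 then 2 * int (order a P) else if P = 0 then 2 * int (order a Q) + 1
      else min (2 * int (order a P)) (2 * int (order a Q) + 1))"
    unfolding eval_ratfun_poly by (rule has_ord_add_parity[OF 1 2 3 assms(2)])
qed

lemma ord_at_infinity:
  assumes "P \<noteq> 0 \<or> Q \<noteq> 0"
  shows   "ord_at f None (to_fract P, to_fract Q) =
             (if Q = 0 then - 2 * int (degree P) else if P = 0 then - 2 * int (degree Q) - int (2 * g + 1)
              else min (- 2 * int (degree P)) (- 2 * int (degree Q) - int (2 * g + 1)))"
proof (rule ord_at_eqI)
  show "None \<in> curve f"
    by (simp add: curve_def)
  fix \<phi> assume \<phi>: "local_param f None \<phi>"
  note coords = infinity_coordinate[OF \<phi>]
  have 1: "has_ord (\<lambda>t. poly P (fst (\<phi> t))) (- 2 * int (degree P))" if "P \<noteq> 0"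
    using has_ord_poly_pole[OF coords(1) _ that] by (simp add: mult.commute)
  have 2: "has_ord (\<lambda>t. poly Q (fst (\<phi> t)) * snd (\<phi> t)) (- 2 * int (degree Q) - int (2 * g + 1))"
    if "Q \<noteq> 0"
  proof -
    have exponent: "- 2 * int (degree Q) - int (2 * g + 1) = - (int (degree Q) * 2) + - int (2 * g + 1)"
      by simp
    show ?thesis
      unfolding exponent by (intro has_ord_mult has_ord_poly_pole coords that) simp
  qed
  have 3: "- 2 * int (degree P) \<noteq> - 2 * int (degree Q) - int (2 * g + 1)"
    by presburger
  show "has_ord (\<lambda>t. eval_ratfun (to_fract P, to_fract Q) (\<phi> t))
     (if Q = 0 then - 2 * int (degree P) else if P = 0 then - 2 * int (degree Q) - int (2 * g + 1)
      else min (- 2 * int (degree P)) (- 2 * int (degree Q) - int (2 * g + 1)))"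
    unfolding eval_ratfun_poly by (rule has_ord_add_parity[OF 1 2 3 assms])
qed

text \<open>
  As \<open>f\<close> has odd degree, it is not a square in the field of rational functions.
\<close>

lemma norm_form_anisotropic:
  assumes "P ^ 2 = Q ^ 2 * f"
  shows   "P = 0 \<and> Q = 0"
proof -
  have "Q = 0"
  proof (rule ccontr)
    assume "Q \<noteq> 0"
    then have "degree (Q ^ 2 * f) = 2 * degree Q + (2 * g + 1)"
      using f_nonzero by (simp add: degree_mult_eq degree_power_eq degree_f)
    moreover have "P \<noteq> 0"
      using assms \<open>Q \<noteq> 0\<close> f_nonzero by auto
    then have "degree (P ^ 2) = 2 * degree P"
      by (simp add: degree_power_eq)
    ultimately have "2 * degree P = 2 * degree Q + (2 * g + 1)"
      using assms by simp
    then show False by presburger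
  qed
  with assms show ?thesis by simp
qed

lemma affine_coordinate:
  assumes "local_param f (Some (a, b)) \<phi>"
  obtains e where "e > 0" "has_ord (\<lambda>t. fst (\<phi> t) - a) e"
  using ordinary_point_coordinate[of a b \<phi>] branch_point_coordinate(2)[of a \<phi>] assms
  by (cases "b = 0") (auto intro: that[of 1] that[of 2])

text \<open>
  The norm \<open>P\<^sup>2 - Q\<^sup>2 f\<close> of \<open>P + Q y\<close> is a nonzero polynomial in \<open>x\<close>, so \<open>P + Q y\<close> cannot vanish
  identically along a parameter; its order is then not a default value but that of a regular function.
\<close>

lemma ord_at_affine_nonneg:
  assumes "Some (a, b) \<in> curve f" "P \<noteq> 0 \<or> Q \<noteq> 0"
  shows   "ord_at f (Some (a, b)) (to_fract P, to_fract Q) \<ge> 0"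
proof -
  define \<phi> where "\<phi> = (SOME \<phi>. local_param f (Some (a, b)) \<phi>)"
  have \<phi>: "local_param f (Some (a, b)) \<phi>"
    unfolding \<phi>_def using local_param_exists[OF assms(1)] by (rule someI_ex)
  define u where "u = (\<lambda>t. fst (\<phi> t))"
  define v where "v = (\<lambda>t. snd (\<phi> t))"
  obtain r where r: "punctured_param f u v r" and ou: "ord_ge u 0" and ov: "ord_ge v 0"
    using local_param_expansion[OF \<phi>] unfolding u_def v_def by blast
  define F where "F = (\<lambda>t. poly P (u t) + poly Q (u t) * v t)"
  have F: "(\<lambda>t. eval_ratfun (to_fract P, to_fract Q) (\<phi> t)) = F"
    by (simp add: F_def u_def v_def eval_ratfun_poly)
  have "ord_ge F (0 + 0)"
    unfolding F_def by (intro ord_ge_add ord_ge_mult ord_ge_poly ou ov ord_ge_mono[OF ord_ge_poly[OF ou]]) simp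
  then show ?thesis
  proof (cases rule: ord_ge_cases)
    case zero
    define p where "p = P ^ 2 - Q ^ 2 * f"
    have p: "p \<noteq> 0"
      unfolding p_def using norm_form_anisotropic[of P Q] assms(2) by auto
    obtain e where e: "e > 0" "has_ord (\<lambda>t. u t - a) e"
      using affine_coordinate[OF \<phi>] unfolding u_def by blast
    have "eventually (\<lambda>t. poly p (u t) \<noteq> 0) (at 0)"
      using has_ord_eventually_nonzero[OF has_ord_poly_at[OF e(2,1) p]] .
    with zero punctured_param_eventually[OF r] have "eventually (\<lambda>t::complex. False) (at 0)"
    proof eventually_elim
      case (elim t)
      have "poly p (u t) = F t * (poly P (u t) - poly Q (u t) * v t)"
        using elim(2) by (simp add: p_def F_def power2_eq_square algebra_simps)
      with elim show ?case by simp
    qed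
    then show ?thesis by simp
  next
    case (ord n)
    then show ?thesis
      unfolding ord_at_def \<phi>_def[symmetric] F using has_ord_zorder[OF ord(2)] by simp
  qed
qed

text \<open>
  If \<open>(n1 + n2 y) / d\<close> is regular at \<open>(a, b)\<close> although \<open>d(a) = 0\<close>, the numerator must vanish there. At a
  branch point \<open>d\<close> has even order at least \<open>2\<close> along the curve, so the numerator vanishes to order \<open>2\<close>,
  whereas \<open>n2 y\<close> would contribute order \<open>1\<close> if \<open>n2(a) \<noteq> 0\<close>.
\<close>

lemma vanishing_at_pole:
  assumes d: "poly d a = 0" "d \<noteq> 0" and Q: "Some (a, b) \<in> curve f"
    and ord: "ord_at f (Some (a, b)) (to_fract n1 / to_fract d, to_fract n2 / to_fract d) \<ge> 0"
  shows   "poly n1 a + poly n2 a * b = 0" "b = 0 \<Longrightarrow> poly n2 a = 0"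
proof -
  define \<phi> where "\<phi> = (SOME \<phi>. local_param f (Some (a, b)) \<phi>)"
  have \<phi>: "local_param f (Some (a, b)) \<phi>"
    unfolding \<phi>_def using local_param_exists[OF Q] by (rule someI_ex)
  define u where "u = (\<lambda>t. fst (\<phi> t))"
  define v where "v = (\<lambda>t. snd (\<phi> t))"
  obtain r where r: "punctured_param f u v r" "(u \<longlongrightarrow> a) (at 0)" "(v \<longlongrightarrow> b) (at 0)"
    and ou: "ord_ge u 0" and ov: "ord_ge v 0"
    using local_param_expansion[OF \<phi>] unfolding u_def v_def by blast
  define F where "F = (\<lambda>t. eval_ratfun (to_fract n1 / to_fract d, to_fract n2 / to_fract d) (\<phi> t))"
  define G where "G = (\<lambda>t. poly n1 (u t) + poly n2 (u t) * v t)"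
  have G: "ord_ge G 0"
    unfolding G_def using ord_ge_add[OF ord_ge_poly[OF ou] ord_ge_mult[OF ord_ge_poly[OF ou] ov, simplified]] .
  have od: "order a d \<ge> 1"
    using d order_root[of d a] by simp
  have key: "ord_ge G e" if e: "e > 0" "has_ord (\<lambda>t. u t - a) e" for e
  proof -
    have du: "has_ord (\<lambda>t. poly d (u t)) (int (order a d) * e)"
      using has_ord_poly_at[OF e(2,1) d(2)] .
    have FG: "eventually (\<lambda>t. F t = G t / poly d (u t)) (at 0)"
      using has_ord_eventually_nonzero[OF du]
      by eventually_elim (simp add: F_def G_def eval_ratfun_def case_prod_beta eval_fract_divide
          u_def v_def add_divide_distrib)
    have "ord_ge F (0 - int (order a d) * e)"
      using ord_ge_divide[OF G du] by (rule ord_ge_cong) (use FG in \<open>simp add: eq_commute\<close>)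
    then have "ord_ge F 0"
      using ord ord_ge_of_zorder unfolding ord_at_def \<phi>_def[symmetric] F_def by blast
    from ord_ge_mult[OF this has_ord_imp_ord_ge[OF du]]
    have "ord_ge (\<lambda>t. F t * poly d (u t)) (int (order a d) * e)" by simp
    then have "ord_ge G (int (order a d) * e)"
      by (rule ord_ge_cong) (use FG has_ord_eventually_nonzero[OF du] in eventually_elim, simp)
    moreover have "e \<le> int (order a d) * e"
      using od e(1) by simp
    ultimately show ?thesis
      using ord_ge_mono by blast
  qed
  obtain e where e: "e > 0" "has_ord (\<lambda>t. u t - a) e"
    using affine_coordinate[OF \<phi>] unfolding u_def by blast
  have "ord_ge G 1"
    using ord_ge_mono[OF key[OF e]] e(1) by simp
  then have "(G \<longlongrightarrow> 0) (at 0)"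
    using ord_ge_1_iff_tendsto_0 by blast
  moreover have "(G \<longlongrightarrow> poly n1 a + poly n2 a * b) (at 0)"
    unfolding G_def by (intro tendsto_intros r)
  ultimately show sum0: "poly n1 a + poly n2 a * b = 0"
    using tendsto_unique[of "at (0::complex)"] by fastforce
  show "poly n2 a = 0" if b: "b = 0"
  proof (rule ccontr)
    assume nz: "poly n2 a \<noteq> 0"
    have coords: "has_ord v 1" "has_ord (\<lambda>t. u t - a) 2"
      using branch_point_coordinate \<phi> unfolding u_def v_def b by blast+
    have "ord_ge (\<lambda>t. poly n1 (u t)) 2"
    proof (cases "n1 = 0")
      case False
      have "order a n1 \<ge> 1"
        using False sum0 b order_root[of n1 a] by simp
      then show ?thesis
        using has_ord_poly_at[OF coords(2) _ False] by (intro has_ord_imp_ord_ge') auto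
    qed simp
    from ord_ge_diff[OF key[OF _ coords(2)] this] have "ord_ge (\<lambda>t. poly n2 (u t) * v t) 2"
      by (simp add: G_def)
    moreover have "has_ord (\<lambda>t. poly n2 (u t) * v t) (0 + 1)"
    proof (intro has_ord_mult coords(1))
      have "n2 \<noteq> 0" using nz by auto
      then show "has_ord (\<lambda>t. poly n2 (u t)) 0"
        using has_ord_poly_at[OF coords(2), of n2] nz by (simp add: order_0I)
    qed
    ultimately show False
      using has_ord_le by fastforce
  qed
qed

text \<open>
  Write the function as \<open>(n1 + n2 y) / d\<close> and let \<open>a\<close> be a root of \<open>d\<close>. Regularity at both points
  \<open>(a, b)\<close> and \<open>(a, - b)\<close> over \<open>a\<close> gives \<open>n1(a) = n2(a) = 0\<close>, the case \<open>b = 0\<close> being covered by the second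
  part of the preceding lemma. So \<open>x - a\<close> can be cancelled, and the degree of \<open>d\<close> drops.
\<close>

lemma regular_imp_polynomial:
  assumes "\<And>z. Some z \<in> curve f \<Longrightarrow> ord_at f (Some z) (A, B) \<ge> 0"
  shows   "\<exists>P Q. A = to_fract P \<and> B = to_fract Q"
proof -
  have "\<exists>P Q. A = to_fract P \<and> B = to_fract Q"
    if "d \<noteq> 0" "A = to_fract n1 / to_fract d" "B = to_fract n2 / to_fract d" for n1 n2 d
    using that
  proof (induction "degree d" arbitrary: d n1 n2 rule: less_induct)
    case less
    show ?case
    proof (cases "degree d = 0")
      case True
      then obtain c where c: "d = [:c:]" "c \<noteq> 0"
        using less.prems(1) by (metis degree_eq_zeroE pCons_0_0)
      have "to_fract n / to_fract d = to_fract ([:1 / c:] * n)" for n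
      proof -
        have "to_fract ([:1 / c:] * n) * to_fract d = to_fract n"
          unfolding to_fract_mult[symmetric] using c by simp
        then show ?thesis
          using less.prems(1) by (simp add: field_simps del: to_fract_mult)
      qed
      then show ?thesis
        using less.prems(2,3) by blast
    next
      case False
      then obtain a where a: "poly d a = 0"
        using fundamental_theorem_of_algebra[of d] constant_degree by metis
      define b where "b = csqrt (poly f a)"
      have curve: "Some (a, b) \<in> curve f" "Some (a, - b) \<in> curve f"
        by (auto simp: curve_def affine_curve_def b_def)
      have "poly n1 a + poly n2 a * b = 0" "poly n1 a + poly n2 a * (- b) = 0" "b = 0 \<Longrightarrow> poly n2 a = 0"
        using vanishing_at_pole[OF a less.prems(1)] curve assms unfolding less.prems(2,3) by blast+
      then have "poly n1 a = 0" "poly n2 a = 0"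
        by (auto simp: add_eq_0_iff)
      then obtain m1 m2 d' where *: "n1 = [:- a, 1:] * m1" "n2 = [:- a, 1:] * m2" "d = [:- a, 1:] * d'"
        using a unfolding poly_eq_0_iff_dvd by (elim dvdE)
      have l: "to_fract [:- a, 1:] \<noteq> 0" by simp
      have "d' \<noteq> 0" using less.prems(1) * by auto
      moreover have "degree d' < degree d"
        using \<open>d' \<noteq> 0\<close> unfolding *(3) by (subst degree_mult_eq) auto
      moreover have "A = to_fract m1 / to_fract d'" "B = to_fract m2 / to_fract d'"
        using less.prems(2,3) l unfolding * to_fract_mult by simp_all
      ultimately show ?thesis
        using less.hyps by blast
    qed
  qed
  then show ?thesis
    using common_denominator[of A B] by metis
qed

lemma sections_multiple_of_D:
  assumes "k > g"
  shows   "sections f (\<lambda>P. int k * div_D P) = bounded_functions k (k - g)"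
proof (intro equalityI subsetI)
  fix h assume h: "h \<in> sections f (\<lambda>P. int k * div_D P)"
  show "h \<in> bounded_functions k (k - g)"
  proof (cases "h = 0")
    case True
    then have "h = (to_fract 0, to_fract 0)" by (simp add: zero_prod_def)
    then show ?thesis
      unfolding bounded_functions_def using assms by (auto intro!: exI[of _ 0])
  next
    case False
    obtain A B where AB: "h = (A, B)" by (cases h)
    have reg: "ord_at f P h + int k * div_D P \<ge> 0" if "P \<in> curve f" for P
      using h False that unfolding sections_def by blast
    have "ord_at f (Some z) (A, B) \<ge> 0" if "Some z \<in> curve f" for z
      using reg[OF that] by (simp add: AB div_D_def)
    then obtain P Q where PQ: "A = to_fract P" "B = to_fract Q"
      using regular_imp_polynomial by blast
    have nz: "P \<noteq> 0 \<or> Q \<noteq> 0"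
      using False AB PQ by (auto simp: zero_prod_def)
    have "ord_at f None h + int k * 2 \<ge> 0"
      using reg[of None] by (simp add: curve_def div_D_def)
    then have "degree P \<le> k \<and> degree Q < k - g"
      unfolding AB PQ ord_at_infinity[OF nz] using assms by (auto split: if_splits)
    then show ?thesis
      unfolding bounded_functions_def AB PQ by blast
  qed
next
  fix h assume "h \<in> bounded_functions k (k - g)"
  then obtain P Q where h: "h = (to_fract P, to_fract Q)" "degree P \<le> k" "degree Q < k - g"
    unfolding bounded_functions_def by blast
  show "h \<in> sections f (\<lambda>P. int k * div_D P)"
  proof (cases "P = 0 \<and> Q = 0")
    case True
    then show ?thesis by (simp add: h sections_def zero_prod_def)
  next
    case False
    then have nz: "P \<noteq> 0 \<or> Q \<noteq> 0" by blast
    have "ord_at f z h + int k * div_D z \<ge> 0" if "z \<in> curve f" for z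
    proof (cases z)
      case None
      have "int (degree P) \<le> int k" "int (degree Q) + int g < int k"
        using h(2,3) by linarith+
      with None show ?thesis
        using nz by (auto simp: div_D_def h(1) ord_at_infinity[OF nz] min_def)
    next
      case (Some c)
      obtain a b where "c = (a, b)" by (cases c)
      then show ?thesis
        using ord_at_affine_nonneg[of a b P Q] nz that Some by (simp add: div_D_def h(1))
    qed
    then show ?thesis unfolding sections_def by blast
  qed
qed

end

section \<open>Vanishing orders at ordinary points\<close>

lemma order_0_eqI:
  fixes E :: "complex poly"
  assumes "coeff E m \<noteq> 0" "\<And>i. i < m \<Longrightarrow> coeff E i = 0"
  shows   "E \<noteq> 0" "order 0 E = m"
proof -
  show nz: "E \<noteq> 0" using assms(1) by auto
  have "m \<le> order 0 E"
    using assms(2) monom_1_dvd_iff[OF nz] monom_1_dvd_iff'[of m E] by blast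
  moreover have "\<not> Suc m \<le> order 0 E"
    using assms(1) monom_1_dvd_iff[OF nz, of "Suc m"] monom_1_dvd_iff'[of "Suc m" E] by blast
  ultimately show "order 0 E = m" by simp
qed

context hyperelliptic
begin

text \<open>
  The expansion of \<open>P(x) + Q(x) y\<close> at \<open>(a, b)\<close> in the coordinate \<open>(x - a) / b\<^sup>2\<close>, with \<open>y / b\<close> replaced by
  its truncation.
\<close>

definition jet :: "nat \<Rightarrow> complex \<Rightarrow> complex \<Rightarrow> complex poly \<Rightarrow> complex poly \<Rightarrow> complex poly" where
  "jet N a b P Q = pcompose P [:a, b ^ 2:] + Polynomial.smult b (pcompose Q [:a, b ^ 2:]) * sqrt_jet f N a"

text \<open>
  With \<open>S\<close> the truncated square root, \<open>(y - b S(w)) (y + b S(w)) = f(x) - b\<^sup>2 S(w)\<^sup>2\<close> vanishes to order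
  \<open>N\<close>, while the second factor tends to \<open>2 b \<noteq> 0\<close>. So \<open>b S(w)\<close> agrees with \<open>y\<close> to order \<open>N\<close>; no power
  series expansion of \<open>y\<close> itself is needed.
\<close>

lemma ordinary_point_jet:
  assumes \<phi>: "local_param f (Some (a, b)) \<phi>" and b: "b \<noteq> 0" and N: "N > 0"
  defines "w \<equiv> \<lambda>t. (fst (\<phi> t) - a) / b ^ 2"
  shows   "has_ord w 1"
    and "ord_ge (\<lambda>t. eval_ratfun (to_fract P, to_fract Q) (\<phi> t) - poly (jet N a b P Q) (w t)) N"
proof -
  define u where "u = (\<lambda>t. fst (\<phi> t))"
  define v where "v = (\<lambda>t. snd (\<phi> t))"
  obtain r where r: "punctured_param f u v r" "(u \<longlongrightarrow> a) (at 0)" "(v \<longlongrightarrow> b) (at 0)"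
    and ou: "ord_ge u 0" and ov: "ord_ge v 0"
    using local_param_expansion[OF \<phi>] unfolding u_def v_def by blast
  have curve_a: "b ^ 2 = poly f a"
    using \<phi> by (simp add: local_param_Some_iff)
  have "has_ord (\<lambda>t. (u t - a) / b ^ 2) (1 - 0)"
    unfolding u_def by (intro has_ord_divide ordinary_point_coordinate[OF \<phi> b] has_ord_const) (use b in simp)
  then show w: "has_ord w 1"
    by (simp add: w_def u_def)
  have uw: "a + b ^ 2 * w t = u t" for t
    using b by (simp add: w_def u_def)
  have subst: "poly (pcompose p [:a, b ^ 2:]) (w t) = poly p (u t)" for p t
    using uw[of t] by (simp add: poly_pcompose mult.commute)
  have w0: "ord_ge w 0"
    using has_ord_imp_ord_ge'[OF w] by simp
  define S where "S = sqrt_jet f N a"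
  define D where "D = pcompose f [:a, b ^ 2:] - Polynomial.smult (b ^ 2) (S ^ 2)"
  obtain R where R: "D = monom 1 N * R"
    using sqrt_jet_approximates[OF curve_a, of N] unfolding D_def S_def by blast
  have "ord_ge (\<lambda>t. w t ^ N * poly R (w t)) (int N * 1 + 0)"
    by (intro ord_ge_mult ord_ge_poly w0 has_ord_imp_ord_ge has_ord_power w)
  then have D: "ord_ge (\<lambda>t. poly D (w t)) N"
    by (simp add: R poly_monom)
  define p where "p = (\<lambda>t. v t + b * poly S (w t))"
  have "ord_ge p 0"
    unfolding p_def using ord_ge_add[OF ov ord_ge_mult[OF ord_ge_const ord_ge_poly[OF w0], simplified]] .
  moreover have "(w \<longlongrightarrow> 0) (at 0)"
    using ord_ge_1_iff_tendsto_0[OF w0] has_ord_imp_ord_ge[OF w] by blast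
  then have "(p \<longlongrightarrow> b + b * poly S 0) (at 0)"
    unfolding p_def by (intro tendsto_intros r)
  moreover have "poly S 0 = 1"
    using N by (simp add: S_def poly_0_coeff_0 coeff_sqrt_jet)
  ultimately have p: "has_ord p 0"
    using has_ord_0I b by fastforce
  have "ord_ge (\<lambda>t. poly D (w t) / p t) (int N - 0)"
    using D p by (rule ord_ge_divide)
  moreover have "eventually (\<lambda>t. poly D (w t) / p t = v t - b * poly S (w t)) (at 0)"
    using punctured_param_eventually[OF r(1)] has_ord_eventually_nonzero[OF p]
  proof eventually_elim
    case (elim t)
    have "poly D (w t) = v t ^ 2 - b ^ 2 * poly S (w t) ^ 2"
      using elim(1) by (simp add: D_def subst)
    also have "\<dots> = (v t - b * poly S (w t)) * p t"
      by (simp add: p_def power2_eq_square algebra_simps)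
    finally show ?case using elim(2) by simp
  qed
  ultimately have "ord_ge (\<lambda>t. v t - b * poly S (w t)) N"
    using ord_ge_cong by fastforce
  from ord_ge_mult[OF ord_ge_poly[OF ou, of Q] this]
  have "ord_ge (\<lambda>t. poly Q (u t) * (v t - b * poly S (w t))) N" by simp
  moreover have "eval_ratfun (to_fract P, to_fract Q) (\<phi> t) - poly (jet N a b P Q) (w t) =
                   poly Q (u t) * (v t - b * poly S (w t))" for t
    by (simp add: eval_ratfun_poly jet_def subst S_def u_def v_def algebra_simps)
  ultimately show "ord_ge (\<lambda>t. eval_ratfun (to_fract P, to_fract Q) (\<phi> t) - poly (jet N a b P Q) (w t)) N"
    by simp
qed

lemma ord_at_ordinary_point:
  assumes "Some (a, b) \<in> curve f" "b \<noteq> 0" "\<not> monom 1 N dvd jet N a b P Q"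
  shows   "ord_at f (Some (a, b)) (to_fract P, to_fract Q) = int (order 0 (jet N a b P Q))"
proof (rule ord_at_eqI[OF assms(1)])
  fix \<phi> assume \<phi>: "local_param f (Some (a, b)) \<phi>"
  define w where "w = (\<lambda>t. (fst (\<phi> t) - a) / b ^ 2)"
  have nz: "jet N a b P Q \<noteq> 0"
    using assms(3) by auto
  have N: "N > 0"
    using assms(3) by (cases N) (auto simp: monom_0 simp flip: one_pCons)
  have w: "has_ord w 1"
    unfolding w_def by (rule ordinary_point_jet(1)[OF \<phi> assms(2) N])
  have error: "ord_ge (\<lambda>t. eval_ratfun (to_fract P, to_fract Q) (\<phi> t) - poly (jet N a b P Q) (w t)) N"
    unfolding w_def by (rule ordinary_point_jet(2)[OF \<phi> assms(2) N])
  have "has_ord (\<lambda>t. poly (jet N a b P Q) (w t)) (int (order 0 (jet N a b P Q)))"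
    using has_ord_poly_at[of w 0 1, OF _ _ nz] w by simp
  moreover have "int (order 0 (jet N a b P Q)) < int N"
    using assms(3) monom_1_dvd_iff[OF nz, of N] by simp
  ultimately have "has_ord (\<lambda>t. poly (jet N a b P Q) (w t) +
      (eval_ratfun (to_fract P, to_fract Q) (\<phi> t) - poly (jet N a b P Q) (w t))) (int (order 0 (jet N a b P Q)))"
    using has_ord_add error by blast
  then show "has_ord (\<lambda>t. eval_ratfun (to_fract P, to_fract Q) (\<phi> t)) (int (order 0 (jet N a b P Q)))"
    by simp
qed

lemma affine_substitution:
  assumes "b \<noteq> (0 :: complex)"
  obtains p where "pcompose p [:a, b:] = q" "degree p = degree q"
proof -
  define p where "p = pcompose q [:- a / b, 1 / b:]"
  have "pcompose [:- a / b, 1 / b:] [:a, b:] = [:0, 1:]"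
    using assms by (simp add: pcompose_pCons)
  then have "pcompose p [:a, b:] = q"
    by (simp add: p_def pcompose_idR flip: pcompose_assoc)
  moreover have "degree p = degree q"
    using assms by (simp add: p_def degree_pcompose)
  ultimately show thesis by (rule that)
qed

text \<open>
  At all but finitely many points the first \<open>N\<close> Taylor coefficients can be prescribed arbitrarily and
  determine the function, so the vanishing orders are \<open>0, \<dots>, N - 1\<close>. The passage from \<open>P(x)\<close> and \<open>Q(x)\<close> to
  polynomials in \<open>(x - a) / b\<^sup>2\<close> preserves the degree bounds.
\<close>

lemma vanishing_orders_generic:
  assumes "d > 0"
  obtains A where "finite A" and
    "\<forall>a b. Some (a, b) \<in> curve f \<longrightarrow> a \<notin> A \<longrightarrow>
       {ord_at f (Some (a, b)) h | h. h \<in> bounded_functions k d \<and> h \<noteq> 0} = int ` {..<k + 1 + d}"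
proof -
  have "degree f \<noteq> 0" by (simp add: degree_f)
  then obtain a0 where a0: "poly f a0 = 0"
    using fundamental_theorem_of_algebra[of f] constant_degree by metis
  define N where "N = k + 1 + d"
  have "coeff (pcompose f [:a0, 1:]) 1 \<noteq> 0"
  proof -
    have "pderiv (pcompose f [:a0, 1:]) = pcompose (pderiv f) [:a0, 1:]"
      by (simp add: pderiv_pcompose pderiv_pCons)
    then have "coeff (pcompose f [:a0, 1:]) 1 = poly (pderiv f) a0"
      using coeff_pderiv[of "pcompose f [:a0, 1:]" 0] by simp
    then show ?thesis using separable[OF a0] by simp
  qed
  then obtain A where A: "finite A"
    "\<And>a P Q. a \<notin> A \<Longrightarrow> degree P \<le> k \<Longrightarrow> degree Q < d \<Longrightarrow>
        monom 1 N dvd P + Q * sqrt_jet f N a \<Longrightarrow> P = 0 \<and> Q = 0"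
    "\<And>a w. a \<notin> A \<Longrightarrow> \<exists>P Q. degree P \<le> k \<and> degree Q < d \<and>
        (\<forall>i<N. coeff (P + Q * sqrt_jet f N a) i = w i)"
    using jets_basis_outside_finite[OF a0 _ assms, of k] unfolding N_def by blast
  have orders: "{ord_at f (Some (a, b)) h | h. h \<in> bounded_functions k d \<and> h \<noteq> 0} = int ` {..<k + 1 + d}"
    if ab: "Some (a, b) \<in> curve f" "a \<notin> A" "poly f a \<noteq> 0" for a b
  proof -
    have b: "b \<noteq> 0"
      using ab by (auto simp: curve_def affine_curve_def)
    have order_less: "order 0 E < N" if "\<not> monom 1 N dvd E" for E :: "complex poly"
    proof -
      have "E \<noteq> 0" using that by auto
      then show ?thesis using that monom_1_dvd_iff[of E N] by simp
    qed
    show ?thesis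
    proof (intro equalityI subsetI)
      fix m assume "m \<in> {ord_at f (Some (a, b)) h | h. h \<in> bounded_functions k d \<and> h \<noteq> 0}"
      then obtain h where h: "m = ord_at f (Some (a, b)) h" "h \<in> bounded_functions k d" "h \<noteq> 0"
        by blast
      then obtain P Q where PQ: "h = (to_fract P, to_fract Q)" "degree P \<le> k" "degree Q < d"
        unfolding bounded_functions_def by blast
      have "P \<noteq> 0 \<or> Q \<noteq> 0"
        using h(3) PQ(1) by (auto simp: zero_prod_def)
      then have "\<not> (pcompose P [:a, b ^ 2:] = 0 \<and> Polynomial.smult b (pcompose Q [:a, b ^ 2:]) = 0)"
        using b by (simp add: pcompose_eq_0_iff)
      moreover have "degree (pcompose P [:a, b ^ 2:]) \<le> k"
          "degree (Polynomial.smult b (pcompose Q [:a, b ^ 2:])) < d"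
        using b PQ(2,3) by (simp_all add: degree_pcompose)
      ultimately have "\<not> monom 1 N dvd jet N a b P Q"
        unfolding jet_def using A(2) ab(2) by blast
      then show "m \<in> int ` {..<k + 1 + d}"
        using ord_at_ordinary_point[OF ab(1) b] order_less unfolding h(1) PQ(1) N_def by simp
    next
      fix m assume "m \<in> int ` {..<k + 1 + d}"
      then obtain i where i: "m = int i" "i < N"
        unfolding N_def by auto
      obtain P' Q' where PQ': "degree P' \<le> k" "degree Q' < d"
          "\<forall>j<N. coeff (P' + Q' * sqrt_jet f N a) j = (if j = i then 1 else 0)"
        using A(3)[of a "\<lambda>j. if j = i then 1 else 0"] ab(2) by blast
      have b2: "b ^ 2 \<noteq> 0" using b by simp
      obtain P where P: "pcompose P [:a, b ^ 2:] = P'" "degree P = degree P'"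
        using affine_substitution[OF b2] .
      obtain Q where Q: "pcompose Q [:a, b ^ 2:] = Polynomial.smult (1 / b) Q'"
          "degree Q = degree (Polynomial.smult (1 / b) Q')"
        using affine_substitution[OF b2] .
      have jet: "jet N a b P Q = P' + Q' * sqrt_jet f N a"
        unfolding jet_def P(1) Q(1) using b by simp
      have ci: "coeff (jet N a b P Q) i \<noteq> 0" "\<And>j. j < i \<Longrightarrow> coeff (jet N a b P Q) j = 0"
        unfolding jet using PQ'(3) i(2) by simp_all
      have "order 0 (jet N a b P Q) = i"
        using order_0_eqI(2)[OF ci] by simp
      moreover have "\<not> monom 1 N dvd jet N a b P Q"
        unfolding monom_1_dvd_iff' using ci(1) i(2) by blast
      ultimately have "ord_at f (Some (a, b)) (to_fract P, to_fract Q) = m"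
        using ord_at_ordinary_point[OF ab(1) b] i(1) by simp
      moreover have "(to_fract P, to_fract Q) \<in> bounded_functions k d"
        using PQ'(1,2) P(2) Q(2) b unfolding bounded_functions_def by auto
      moreover have "(to_fract P, to_fract Q) \<noteq> 0"
      proof
        assume "(to_fract P, to_fract Q) = 0"
        then have "jet N a b P Q = 0"
          by (simp add: zero_prod_def jet_def)
        then show False using ci(1) by simp
      qed
      ultimately show "m \<in> {ord_at f (Some (a, b)) h | h. h \<in> bounded_functions k d \<and> h \<noteq> 0}"
        by blast
    qed
  qed
  show thesis
  proof (rule that)
    show "finite (A \<union> {a. poly f a = 0})"
      using A(1) poly_roots_finite[OF f_nonzero] by simp
    show "\<forall>a b. Some (a, b) \<in> curve f \<longrightarrow> a \<notin> A \<union> {a. poly f a = 0} \<longrightarrow>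
        {ord_at f (Some (a, b)) h | h. h \<in> bounded_functions k d \<and> h \<noteq> 0} = int ` {..<k + 1 + d}"
      using orders by simp
  qed
qed

end

section \<open>Inflectionary weights and the count\<close>

text \<open>
  Only for a finite set of vanishing orders: the sorted list of an infinite set is empty, and the weight
  is then \<open>0\<close> by convention.
\<close>

lemma inflection_weight_sum:
  assumes "finite (vanishing_orders f E V P)"
  shows   "inflection_weight f E V P =
             \<Sum>(vanishing_orders f E V P) - (\<Sum>i<card (vanishing_orders f E V P). int i)"
proof -
  define os where "os = sorted_list_of_set (vanishing_orders f E V P)"
  have os: "distinct os" "set os = vanishing_orders f E V P" "length os = card (vanishing_orders f E V P)"
    using assms by (simp_all add: os_def)
  have "(\<Sum>i<length os. os ! i) = \<Sum>(set os)"
    using os(1) by (simp add: sum_list_sum_nth atLeast0LessThan flip: sum_list_distinct_conv_sum_set[of os "\<lambda>x. x", simplified])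
  then show ?thesis
    unfolding inflection_weight_def Let_def os_def[symmetric] by (simp add: sum_subtractf os)
qed

lemma inflection_weight_nonneg:
  assumes "\<And>m. m \<in> vanishing_orders f E V P \<Longrightarrow> m \<ge> 0"
  shows   "inflection_weight f E V P \<ge> 0"
proof (cases "finite (vanishing_orders f E V P)")
  case True
  define os where "os = sorted_list_of_set (vanishing_orders f E V P)"
  have os: "sorted_wrt (<) os" "set os = vanishing_orders f E V P"
    using True by (simp_all add: os_def)
  have "int i \<le> os ! i" if "i < length os" for i
    using that
  proof (induction i)
    case 0
    then show ?case using assms[of "os ! 0"] os(2) nth_mem[of 0 os] by simp
  next
    case (Suc i)
    have "os ! i < os ! Suc i"
      using sorted_wrt_nth_less[OF os(1), of i "Suc i"] Suc.prems by simp
    then show ?case using Suc.IH Suc.prems by simp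
  qed
  then show ?thesis
    unfolding inflection_weight_def Let_def os_def[symmetric] by (intro sum_nonneg) simp
next
  case False
  then show ?thesis by (simp add: inflection_weight_def)
qed

text \<open>
  The vanishing orders at a Weierstrass point: the even ones come from the polynomials in \<open>x\<close>, the odd
  ones from their multiples of \<open>y\<close>.
\<close>

definition branch_orders :: "nat \<Rightarrow> nat \<Rightarrow> int set" where
  "branch_orders k d = (\<lambda>i. 2 * int i) ` {..k} \<union> (\<lambda>j. 2 * int j + 1) ` {..<d}"

lemma finite_branch_orders: "finite (branch_orders k d)"
  by (simp add: branch_orders_def)

lemma branch_orders_disjoint: "(\<lambda>i. 2 * int i) ` A \<inter> (\<lambda>j. 2 * int j + 1) ` B = {}"
proof -
  have "2 * int i \<noteq> 2 * int j + 1" for i j by presburger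
  then show ?thesis by blast
qed

lemma card_branch_orders: "card (branch_orders k d) = k + 1 + d"
  unfolding branch_orders_def
  by (subst card_Un_disjoint[OF _ _ branch_orders_disjoint]) (simp_all add: card_image inj_on_def)

lemma sum_branch_orders: "\<Sum>(branch_orders k d) = int (k * (k + 1) + d * d)"
proof -
  have "(\<Sum>i\<le>k. 2 * int i) = int (k * (k + 1))"
    by (induction k) (simp_all add: algebra_simps)
  moreover have "(\<Sum>j<d. 2 * int j + 1) = int (d * d)"
    by (induction d) (simp_all add: algebra_simps)
  ultimately show ?thesis
    unfolding branch_orders_def
    by (subst sum.union_disjoint[OF _ _ branch_orders_disjoint]) (simp_all add: sum.reindex inj_on_def)
qed

text \<open>
  Compared with \<open>0, \<dots>, g + 2 d\<close>, the odd numbers from \<open>2 d + 1\<close> on are skipped, which shifts the last \<open>g\<close>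
  even orders by \<open>1, \<dots>, g\<close>; so the weight is \<open>g (g + 1) / 2\<close>.
\<close>

lemma branch_orders_weight:
  "2 * (\<Sum>(branch_orders (g + d) d) - (\<Sum>i<card (branch_orders (g + d) d). int i)) = int (g * (g + 1))"
proof -
  have gauss: "2 * (\<Sum>i<m. int i) = int m * (int m - 1)" for m
    by (induction m) (simp_all add: algebra_simps)
  have "2 * (\<Sum>(branch_orders (g + d) d) - (\<Sum>i<card (branch_orders (g + d) d). int i)) =
          2 * int ((g + d) * (g + d + 1) + d * d) - int (g + d + 1 + d) * (int (g + d + 1 + d) - 1)"
    unfolding sum_branch_orders card_branch_orders right_diff_distrib gauss ..
  also have "\<dots> = int (g * (g + 1))"
    by (simp add: algebra_simps)
  finally show ?thesis .
qed

context hyperelliptic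
begin

lemma vanishing_orders_multiple_of_D:
  assumes "k > g"
  defines "E \<equiv> \<lambda>P. int k * div_D P"
  shows   "vanishing_orders f E (real_sections f E) P =
             {ord_at f P h + E P | h. h \<in> bounded_functions k (k - g) \<and> h \<noteq> 0}"
  unfolding vanishing_orders_def E_def
    complexification_bounded_functions[OF sections_multiple_of_D[OF assms(1)]] ..

lemma bounded_functions_nonzeroE:
  assumes "h \<in> bounded_functions k d" "h \<noteq> 0"
  obtains P Q where "h = (to_fract P, to_fract Q)" "degree P \<le> k" "degree Q < d" "P \<noteq> 0 \<or> Q \<noteq> 0"
proof -
  obtain P Q where PQ: "h = (to_fract P, to_fract Q)" "degree P \<le> k" "degree Q < d"
    using assms(1) unfolding bounded_functions_def by blast
  moreover have "P \<noteq> 0 \<or> Q \<noteq> 0"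
    using assms(2) PQ(1) by (auto simp: zero_prod_def)
  ultimately show thesis by (rule that)
qed

lemma bounded_functions_nonzeroI:
  "degree P \<le> k \<Longrightarrow> degree Q < d \<Longrightarrow> P \<noteq> 0 \<or> Q \<noteq> 0 \<Longrightarrow>
     (to_fract P, to_fract Q) \<in> bounded_functions k d \<and> (to_fract P, to_fract Q) \<noteq> 0"
  unfolding bounded_functions_def by (auto simp: zero_prod_def)

lemma bounded_function_ordersI:
  assumes "m = ord_at f z (to_fract P, to_fract Q) + c"
    and "degree P \<le> k" "degree Q < d" "P \<noteq> 0 \<or> Q \<noteq> 0"
  shows   "m \<in> {ord_at f z h + c | h. h \<in> bounded_functions k d \<and> h \<noteq> 0}"
  using bounded_functions_nonzeroI[OF assms(2-4)] assms(1) by blast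

lemma vanishing_orders_branch_point:
  assumes "poly f a = 0" "d > 0"
  shows   "{ord_at f (Some (a, 0)) h | h. h \<in> bounded_functions k d \<and> h \<noteq> 0} = branch_orders k d"
proof (intro equalityI subsetI)
  fix m assume "m \<in> {ord_at f (Some (a, 0)) h | h. h \<in> bounded_functions k d \<and> h \<noteq> 0}"
  then obtain h where h: "m = ord_at f (Some (a, 0)) h" "h \<in> bounded_functions k d" "h \<noteq> 0"
    by blast
  obtain P Q where hPQ: "h = (to_fract P, to_fract Q)"
      and deg: "degree P \<le> k" "degree Q < d" and nz: "P \<noteq> 0 \<or> Q \<noteq> 0"
    using bounded_functions_nonzeroE[OF h(2,3)] .
  note PQ = h(1)[unfolded hPQ] deg nz
  have "order a P \<le> k" if "P \<noteq> 0"
    using order_degree[OF that, of a] PQ(2) by simp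
  moreover have "order a Q < d" if "Q \<noteq> 0"
    using order_degree[OF that, of a] PQ(3) by simp
  moreover have "P \<noteq> 0 \<and> m = 2 * int (order a P) \<or> Q \<noteq> 0 \<and> m = 2 * int (order a Q) + 1"
    unfolding PQ(1) ord_at_branch_point[OF assms(1) PQ(4)] min_def using PQ(4) by simp
  ultimately show "m \<in> branch_orders k d"
    unfolding branch_orders_def by blast
next
  fix m assume "m \<in> branch_orders k d"
  then consider (even) i where "i \<le> k" "m = 2 * int i" | (odd) j where "j < d" "m = 2 * int j + 1"
    unfolding branch_orders_def by blast
  then show "m \<in> {ord_at f (Some (a, 0)) h | h. h \<in> bounded_functions k d \<and> h \<noteq> 0}"
  proof cases
    case even
    define P where "P = [:- a, 1:] ^ i"
    have P: "P \<noteq> 0" "order a P = i" "degree P = i"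
      by (simp_all add: P_def order_power_n_n degree_power_eq)
    have "m = ord_at f (Some (a, 0)) (to_fract P, to_fract 0)"
      using P ord_at_branch_point[OF assms(1), of P 0] even by simp
    then show ?thesis
      using bounded_function_ordersI[of m _ P 0 0 k d] P even(1) assms(2) by simp
  next
    case odd
    define Q where "Q = [:- a, 1:] ^ j"
    have Q: "Q \<noteq> 0" "order a Q = j" "degree Q = j"
      by (simp_all add: Q_def order_power_n_n degree_power_eq)
    have "m = ord_at f (Some (a, 0)) (to_fract 0, to_fract Q)"
      using Q ord_at_branch_point[OF assms(1), of 0 Q] odd by simp
    then show ?thesis
      using bounded_function_ordersI[of m _ 0 Q 0 k d] Q odd(1) by simp
  qed
qed

lemma vanishing_orders_infinity:
  assumes "d > 0" "k = g + d"
  shows   "{ord_at f None h + 2 * int k | h. h \<in> bounded_functions k d \<and> h \<noteq> 0} = branch_orders k d"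
proof (intro equalityI subsetI)
  fix m assume "m \<in> {ord_at f None h + 2 * int k | h. h \<in> bounded_functions k d \<and> h \<noteq> 0}"
  then obtain h where h: "m = ord_at f None h + 2 * int k" "h \<in> bounded_functions k d" "h \<noteq> 0"
    by blast
  obtain P Q where hPQ: "h = (to_fract P, to_fract Q)"
      and deg: "degree P \<le> k" "degree Q < d" and nz: "P \<noteq> 0 \<or> Q \<noteq> 0"
    using bounded_functions_nonzeroE[OF h(2,3)] .
  note PQ = h(1)[unfolded hPQ] deg nz
  have even: "2 * int k - 2 * int (degree P) = 2 * int (k - degree P)"
    using PQ(2) by (simp add: of_nat_diff)
  have odd: "2 * int k - 2 * int (degree Q) - int (2 * g + 1) = 2 * int (d - 1 - degree Q) + 1"
    using PQ(3) assms by (simp add: of_nat_diff)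
  have "m = 2 * int k - 2 * int (degree P) \<or> m = 2 * int k - 2 * int (degree Q) - int (2 * g + 1)"
    unfolding PQ(1) ord_at_infinity[OF PQ(4)] min_def by simp
  then have "m = 2 * int (k - degree P) \<or> m = 2 * int (d - 1 - degree Q) + 1"
    unfolding even odd .
  moreover have "k - degree P \<in> {..k}" "d - 1 - degree Q \<in> {..<d}"
    using assms(1) by auto
  ultimately show "m \<in> branch_orders k d"
    unfolding branch_orders_def by blast
next
  fix m assume "m \<in> branch_orders k d"
  then consider (even) i where "i \<le> k" "m = 2 * int i" | (odd) j where "j < d" "m = 2 * int j + 1"
    unfolding branch_orders_def by blast
  then show "m \<in> {ord_at f None h + 2 * int k | h. h \<in> bounded_functions k d \<and> h \<noteq> 0}"
  proof cases
    case even
    define P :: "complex poly" where "P = monom 1 (k - i)"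
    have P: "P \<noteq> 0" "degree P = k - i"
      by (simp_all add: P_def degree_monom_eq)
    have "m = ord_at f None (to_fract P, to_fract 0) + 2 * int k"
      using P ord_at_infinity[of P 0] even by (simp add: of_nat_diff)
    then show ?thesis
      by (rule bounded_function_ordersI) (use P assms(1) in simp_all)
  next
    case odd
    define Q :: "complex poly" where "Q = monom 1 (d - 1 - j)"
    have Q: "Q \<noteq> 0" "degree Q = d - 1 - j"
      by (simp_all add: Q_def degree_monom_eq)
    have "m = ord_at f None (to_fract 0, to_fract Q) + 2 * int k"
      using Q ord_at_infinity[of 0 Q] odd assms(2) by (simp add: of_nat_diff)
    then show ?thesis
      by (rule bounded_function_ordersI) (use Q odd(1) assms(1) in simp_all)
  qed
qed

lemma inflection_weight_weierstrass:
  assumes "k > g" "P = None \<or> (\<exists>a. P = Some (a, 0) \<and> poly f a = 0)"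
  defines "E \<equiv> \<lambda>P. int k * div_D P"
  shows   "2 * inflection_weight f E (real_sections f E) P = int (g * (g + 1))"
proof -
  define d where "d = k - g"
  have d: "d > 0" "k = g + d"
    using assms(1) by (simp_all add: d_def)
  have "vanishing_orders f E (real_sections f E) P = branch_orders k d"
    using assms(2)
  proof (elim disjE exE conjE)
    assume "P = None"
    then show ?thesis
      using vanishing_orders_infinity[OF d] vanishing_orders_multiple_of_D[OF assms(1), of P]
      by (simp add: E_def div_D_def d_def mult.commute)
  next
    fix a assume "P = Some (a, 0)" "poly f a = 0"
    then show ?thesis
      using vanishing_orders_branch_point[OF _ d(1)] vanishing_orders_multiple_of_D[OF assms(1), of P]
      by (simp add: E_def div_D_def d_def)
  qed
  then show ?thesis
    using inflection_weight_sum[of f E "real_sections f E" P] finite_branch_orders[of k d]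
      branch_orders_weight[of g d] d(2) by simp
qed

lemma inflection_weight_multiple_of_D_nonneg:
  assumes "k > g" "P \<in> curve f"
  defines "E \<equiv> \<lambda>P. int k * div_D P"
  shows   "inflection_weight f E (real_sections f E) P \<ge> 0"
proof (rule inflection_weight_nonneg)
  fix m assume "m \<in> vanishing_orders f E (real_sections f E) P"
  then obtain h where h: "m = ord_at f P h + E P" "h \<in> bounded_functions k (k - g)" "h \<noteq> 0"
    using vanishing_orders_multiple_of_D[OF assms(1)] unfolding E_def by blast
  then have "h \<in> sections f E"
    using sections_multiple_of_D[OF assms(1)] by (simp add: E_def)
  then show "m \<ge> 0"
    using h(1,3) assms(2) unfolding sections_def by blast
qed

text \<open>
  The number of real inflection points is a sum over the points of nonzero weight, which would be \<open>0\<close>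
  if there were infinitely many of them. So finiteness is indispensable for a lower bound.
\<close>

lemma finite_inflection_points:
  assumes "k > g"
  defines "E \<equiv> \<lambda>P. int k * div_D P"
  shows   "finite {P \<in> curve f. inflection_weight f E (real_sections f E) P \<noteq> 0}"
proof -
  define d where "d = k - g"
  have d: "d > 0" using assms(1) by (simp add: d_def)
  obtain A where A: "finite A" "\<forall>a b. Some (a, b) \<in> curve f \<longrightarrow> a \<notin> A \<longrightarrow>
       {ord_at f (Some (a, b)) h | h. h \<in> bounded_functions k d \<and> h \<noteq> 0} = int ` {..<k + 1 + d}"
    using vanishing_orders_generic[OF d, of k] .
  have zero: "inflection_weight f E (real_sections f E) (Some (a, b)) = 0"
    if "Some (a, b) \<in> curve f" "a \<notin> A" for a b
  proof -
    have "vanishing_orders f E (real_sections f E) (Some (a, b)) = int ` {..<k + 1 + d}"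
      using A(2)[rule_format, OF that] vanishing_orders_multiple_of_D[OF assms(1), of "Some (a, b)"]
      by (simp add: E_def div_D_def d_def)
    then show ?thesis
      using inflection_weight_sum[of f E "real_sections f E" "Some (a, b)"]
      by (simp add: sum.reindex card_image comp_def)
  qed
  have "{P \<in> curve f. inflection_weight f E (real_sections f E) P \<noteq> 0} \<subseteq>
          insert None (\<Union>a\<in>A. (\<lambda>b. Some (a, b)) ` {csqrt (poly f a), - csqrt (poly f a)})"
  proof
    fix P assume P: "P \<in> {P \<in> curve f. inflection_weight f E (real_sections f E) P \<noteq> 0}"
    show "P \<in> insert None (\<Union>a\<in>A. (\<lambda>b. Some (a, b)) ` {csqrt (poly f a), - csqrt (poly f a)})"
    proof (cases P)
      case (Some z)
      obtain a b where z: "z = (a, b)" by (cases z)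
      have a: "a \<in> A"
      proof (rule ccontr)
        assume "a \<notin> A"
        then show False using zero[of a b] P by (simp add: Some z)
      qed
      have "b ^ 2 = csqrt (poly f a) ^ 2"
        using P by (simp add: Some z curve_def affine_curve_def image_iff)
      then have "b = csqrt (poly f a) \<or> b = - csqrt (poly f a)"
        unfolding power2_eq_iff .
      with a show ?thesis unfolding Some z by blast
    qed simp
  qed
  moreover have "finite (insert None (\<Union>a\<in>A. (\<lambda>b. Some (a, b)) ` {csqrt (poly f a), - csqrt (poly f a)}))"
    using A(1) by simp
  ultimately show ?thesis
    by (rule finite_subset)
qed

text \<open>
  Weights are nonnegative, so it suffices to add up those at infinity and at the points above the real
  roots in \<open>R\<close>, all of which are fixed by the real structure.
\<close>

lemma num_real_inflection_ge:
  assumes "k > g" "g \<ge> 1" "finite R" "\<And>x. x \<in> R \<Longrightarrow> poly f (complex_of_real x) = 0"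
  defines "E \<equiv> \<lambda>P. int k * div_D P"
  shows   "2 * num_real_inflection f E (real_sections f E) \<ge> int ((card R + 1) * (g * (g + 1)))"
proof -
  define w where "w P = inflection_weight f E (real_sections f E) P" for P
  define T :: "point set" where "T = insert None ((\<lambda>x. Some (complex_of_real x, 0)) ` R)"
  have w: "2 * w P = int (g * (g + 1))" if "P \<in> T" for P
    unfolding w_def E_def
  proof (rule inflection_weight_weierstrass[OF assms(1)])
    show "P = None \<or> (\<exists>a. P = Some (a, 0) \<and> poly f a = 0)"
      using that assms(4) unfolding T_def by blast
  qed
  have real: "real_points f \<subseteq> curve f"
    by (auto simp: real_points_def)
  have "T \<subseteq> {P. P \<in> real_points f \<and> w P \<noteq> 0}"
  proof
    fix P assume P: "P \<in> T"
    then consider "P = None" | x where "x \<in> R" "P = Some (complex_of_real x, 0)"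
      by (auto simp: T_def)
    then have "P \<in> real_points f"
      by cases (simp_all add: assms(4) real_points_def curve_def affine_curve_def conj_curve_def
          conj_affine_def image_iff)
    moreover have "w P \<noteq> 0"
    proof
      assume "w P = 0"
      with w[OF P] have "int (g * (g + 1)) = 0"
        by (simp only: mult_zero_right)
      then have "g * (g + 1) = 0"
        by (simp only: of_nat_eq_0_iff)
      then show False
        using assms(2) by simp
    qed
    ultimately show "P \<in> {P. P \<in> real_points f \<and> w P \<noteq> 0}" by simp
  qed
  moreover have "finite {P. P \<in> real_points f \<and> w P \<noteq> 0}"
  proof (rule finite_subset)
    show "{P. P \<in> real_points f \<and> w P \<noteq> 0} \<subseteq> {P \<in> curve f. w P \<noteq> 0}"
      using real by blast
    show "finite {P \<in> curve f. w P \<noteq> 0}"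
      unfolding w_def E_def by (rule finite_inflection_points[OF assms(1)])
  qed
  moreover have "w P \<ge> 0" if "P \<in> real_points f" for P
    unfolding w_def E_def
    by (rule inflection_weight_multiple_of_D_nonneg[OF assms(1) subsetD[OF real that]])
  ultimately have "(\<Sum>P\<in>T. w P) \<le> (\<Sum>P | P \<in> real_points f \<and> w P \<noteq> 0. w P)"
    by (intro sum_mono2) (simp_all only: mem_Collect_eq Diff_iff)
  then have "2 * num_real_inflection f E (real_sections f E) \<ge> (\<Sum>P\<in>T. 2 * w P)"
    unfolding num_real_inflection_def w_def sum_distrib_left[symmetric] by simp
  also have "(\<Sum>P\<in>T. 2 * w P) = int (card T * (g * (g + 1)))"
    using w by simp
  also have "card T = card R + 1"
  proof -
    have "inj_on (\<lambda>x. Some (complex_of_real x, 0 :: complex)) R"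
      by (rule inj_onI) simp
    then show ?thesis
      unfolding T_def using assms(3) by (subst card_insert_disjoint) (simp_all add: card_image image_iff)
  qed
  finally show ?thesis .
qed

end

lemma hyperelliptic_prod_roots:
  assumes "finite R" "card R = 2 * g + 1"
  shows   "hyperelliptic (\<Prod>r\<in>R. [:- r, 1:]) g"
proof
  have "degree (\<Prod>r\<in>R. [:- r, 1:]) = (\<Sum>r\<in>R. degree [:- r, 1:])"
    by (rule degree_prod_eq_sum_degree) simp
  then show "degree (\<Prod>r\<in>R. [:- r, 1:]) = 2 * g + 1"
    using assms(2) by simp
  fix a assume "poly (\<Prod>r\<in>R. [:- r, 1:]) a = 0"
  then have "a \<in> R"
    using assms(1) by (auto simp: poly_prod)
  then have split: "(\<Prod>r\<in>R. [:- r, 1:]) = [:- a, 1:] * (\<Prod>r\<in>R - {a}. [:- r, 1:])"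
    using assms(1) by (simp add: prod.remove)
  have "poly (pderiv (\<Prod>r\<in>R. [:- r, 1:])) a = poly (\<Prod>r\<in>R - {a}. [:- r, 1:]) a"
    unfolding split pderiv_mult by (simp add: pderiv_pCons)
  also have "\<dots> \<noteq> 0"
    using assms(1) by (auto simp: poly_prod)
  finally show "poly (pderiv (\<Prod>r\<in>R. [:- r, 1:])) a \<noteq> 0" .
qed

theorem theorem2:
  fixes g n k :: nat and p :: "nat \<Rightarrow> real" and q :: "nat \<Rightarrow> complex" and f :: "complex poly"
  assumes "g \<ge> 1" and "n \<ge> 1" and "n \<le> g + 1"
    and f: "f = [:0, 1:] * (\<Prod>i=1..2*n-2. [:- complex_of_real (p i), 1:]) *
                (\<Prod>j=1..g+1-n. [:- q j, 1:] * [:- cnj (q j), 1:])"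
    and "\<And>i. i \<in> {1..2*n-2} \<Longrightarrow> p i \<noteq> 0"
    and "\<And>j. j \<in> {1..g+1-n} \<Longrightarrow> q j \<notin> \<real>"
    and "distinct (0 # map (\<lambda>i. complex_of_real (p i)) [1..<Suc (2*n-2)] @
                   map q [1..<Suc (g+1-n)] @ map (\<lambda>j. cnj (q j)) [1..<Suc (g+1-n)])"
    and "num_real_components f = n"
    and "k > g"
  shows "num_real_inflection f (\<lambda>P. int k * div_D P)
           (real_sections f (\<lambda>P. int k * div_D P)) \<ge> int (g * (g + 1) * n)"
proof -
  define m where "m = 2 * n - 2"
  define l where "l = g + 1 - n"
  define L where "L = 0 # map (\<lambda>i. complex_of_real (p i)) [1..<Suc m] @
                        map q [1..<Suc l] @ map (\<lambda>j. cnj (q j)) [1..<Suc l]"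
  have L: "distinct L"
    using assms(7) unfolding L_def m_def l_def .
  have interval_prod: "(\<Prod>i=Suc 0..j. h i) = prod_list (map h [Suc 0..<Suc j])" for j and h :: "nat \<Rightarrow> complex poly"
    by (simp add: prod.distinct_set_conv_list[symmetric] atLeastLessThanSuc_atLeastAtMost del: upt_Suc)
  have "f = prod_list (map (\<lambda>r. [:- r, 1:]) L)"
    unfolding f L_def m_def[symmetric] l_def[symmetric]
    by (simp add: prod.distrib comp_def interval_prod mult.assoc
        del: upt_Suc mult_pCons_left mult_pCons_right)
  also have "\<dots> = (\<Prod>r\<in>set L. [:- r, 1:])"
    using L by (simp only: prod.distinct_set_conv_list)
  finally have f_L: "f = (\<Prod>r\<in>set L. [:- r, 1:])" .
  have "card (set L) = length L"
    using L by (rule distinct_card)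
  also have "length L = 1 + m + l + l"
    by (simp add: L_def del: upt_Suc)
  also have "\<dots> = 2 * g + 1"
    using assms(2,3) unfolding m_def l_def by linarith
  finally interpret hyperelliptic f g
    unfolding f_L by (intro hyperelliptic_prod_roots) simp_all
  \<comment> \<open>the \<open>2 n - 1\<close> real roots give, together with infinity, \<open>2 n\<close> real Weierstrass points\<close>
  define R where "R = insert 0 (p ` {1..m})"
  have "distinct (map (\<lambda>i. complex_of_real (p i)) [1..<Suc m])"
    using L unfolding L_def distinct.simps distinct_append by blast
  then have inj: "inj_on (\<lambda>i. complex_of_real (p i)) {1..m}"
    by (simp only: distinct_map set_upt atLeastLessThanSuc_atLeastAtMost)
  have "inj_on p {1..m}"
  proof (rule inj_onI)
    fix i j assume "i \<in> {1..m}" "j \<in> {1..m}" "p i = p j"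
    then show "i = j" using inj_onD[OF inj, of i j] by simp
  qed
  moreover have "0 \<notin> p ` {1..m}"
  proof
    assume "0 \<in> p ` {1..m}"
    then obtain i where "i \<in> {1..m}" "p i = 0" by (elim imageE) simp
    then show False using assms(5) unfolding m_def by blast
  qed
  ultimately have "card R = m + 1"
    by (simp add: R_def card_image)
  then have card_R: "card R + 1 = 2 * n"
    using assms(2) by (simp add: m_def)
  have "complex_of_real x \<in> set L" if "x \<in> R" for x
  proof -
    have "x = 0 \<or> x \<in> p ` set [1..<Suc m]"
      using that by (simp add: R_def atLeastLessThanSuc_atLeastAtMost del: upt_Suc)
    then show ?thesis
      unfolding L_def by (elim disjE imageE) (simp_all del: upt_Suc)
  qed
  then have "poly f (complex_of_real x) = 0" if "x \<in> R" for x
    unfolding f_L poly_prod using that by (intro prod_zero bexI[of _ "complex_of_real x"]) simp_all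
  moreover have "finite R"
    by (simp add: R_def)
  ultimately have "2 * num_real_inflection f (\<lambda>P. int k * div_D P) (real_sections f (\<lambda>P. int k * div_D P)) \<ge>
                     int ((card R + 1) * (g * (g + 1)))"
    using num_real_inflection_ge[OF assms(9,1)] by blast
  moreover have "int ((card R + 1) * (g * (g + 1))) = 2 * int (g * (g + 1) * n)"
    unfolding card_R by (simp add: algebra_simps)
  ultimately show ?thesis by linarith
qed

end
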